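(* Let $(T,\mathcal F,\mu)$ be a $\sigma$-finite, non-atomic, complete measure space, let $E$ be a separable real Banach space and let $p\ge 1$. Let $\{f_n\}$ be a sequence of real-valued Carathéodory functions on $T\times E$ such that, for each $n\in\mathbb N$, $$|f_n(t,x)|\le M(t)+c\|x\|^p$$ for a.e. $t\in T$ and for all $x\in E$, where $M\in L^1(T)$ and $c\ge 0$ (not depending on $n$). Assume that $\{f_n\}$ converges pointwise in $T\times E$ to a Carathéodory function $f$ such that $$|f(t,x)|\le M(t)$$ for a.e. $t\in T$ and for all $x\in E$. Moreover, assume that the set $$D=\{t\in T: f(t,\cdot)\text{ has no global extrema}\}$$ has positive measure. Then, for each $V\in\mathcal V(L^p(T,E))$, for each $u\in V$ and for each sequence $\{\lambda_n\}$ in $\mathbb R$ converging to $\int_T f(t,u(t))\,d\mu$, there exist a sequence $\{u_n\}$ in $V$ converging to $u$ in $L^p(T,E)$ and $\nu\in\mathbb N$ such that $$\int_T f_n(t,u_n(t))\,d\mu=\lambda_n$$ for all $n\ge\nu$.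
   Context: $L^p(T,E)$ is the space of equivalence classes of measurable functions $u:T\to E$ with $\int_T\|u(t)\|_E^p\,d\mu<+\infty$, with norm $\|u\|_{L^p(T,E)}=\left(\int_T\|u(t)\|_E^p\,d\mu\right)^{1/p}$. A function on $T\times E$ is Carathéodory if it is measurable in the first variable and continuous in the second. "$f(t,\cdot)$ has no global extrema" means that $f(t,\cdot):E\to\mathbb R$ has neither a global minimum point nor a global maximum point in $E$. $\mathcal A(T\times E)$ is the class of all Carathéodory functions $g:T\times E\to\mathbb R$ such that, for each $u\in L^p(T,E)$, the function $g(\cdot,u(\cdot))$ lies in $L^1(T)$; for $g\in\mathcal A(T\times E)$ put $J_g(u)=\int_T g(t,u(t))\,d\mu$ for all $u\in L^p(T,E)$. $\mathcal V(L^p(T,E))$ is the family of all sets $V\subseteq L^p(T,E)$ of the form $V=\{u\in L^p(T,E):\Psi(u)=J_g(u)\}$, where $\Psi\in (L^p(T,E))^*$ (continuous linear functional), $g\in\mathcal A(T\times E)$ and $J_g$ is Lipschitzian on $L^p(T,E)$ with Lipschitz constant strictly smaller than the dual norm $\|\Psi\|_{(L^p(T,E))^*}$. *)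

theory Defs
  imports "HOL-Analysis.Analysis"
begin

definition non_atomic :: "'a measure \<Rightarrow> bool" where
  "non_atomic \<mu> \<longleftrightarrow>
     (\<forall>A\<in>sets \<mu>. 0 < emeasure \<mu> A \<longrightarrow>
        (\<exists>B\<in>sets \<mu>. B \<subseteq> A \<and> 0 < emeasure \<mu> B \<and> emeasure \<mu> B < emeasure \<mu> A))"

definition Lp_fun :: "real \<Rightarrow> 'a measure \<Rightarrow> ('a \<Rightarrow> 'e::{banach, second_countable_topology}) set" where
  "Lp_fun p \<mu> = {u \<in> borel_measurable \<mu>. integrable \<mu> (\<lambda>t. norm (u t) powr p)}"

definition Lp_eq :: "real \<Rightarrow> 'a measure
    \<Rightarrow> (('a \<Rightarrow> 'e::{banach, second_countable_topology}) \<times> ('a \<Rightarrow> 'e)) set" where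
  "Lp_eq p \<mu> = {(u, v). u \<in> Lp_fun p \<mu> \<and> v \<in> Lp_fun p \<mu> \<and> (AE t in \<mu>. u t = v t)}"

definition Lp_space :: "real \<Rightarrow> 'a measure
    \<Rightarrow> ('a \<Rightarrow> 'e::{banach, second_countable_topology}) set set" where
  "Lp_space p \<mu> = Lp_fun p \<mu> // Lp_eq p \<mu>"

definition Lp_class :: "real \<Rightarrow> 'a measure \<Rightarrow> ('a \<Rightarrow> 'e::{banach, second_countable_topology})
    \<Rightarrow> ('a \<Rightarrow> 'e) set" where
  "Lp_class p \<mu> u = Lp_eq p \<mu> `` {u}"

text \<open>The operations on classes use an arbitrarily chosen representative. That the choice does
  not matter is recorded in \<open>Lp_add_class\<close>, \<open>Lp_scale_class\<close>, \<open>Lp_norm_class\<close>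
  and \<open>J_class\<close> below.\<close>

definition Lp_rep :: "('a \<Rightarrow> 'e) set \<Rightarrow> 'a \<Rightarrow> 'e" where
  "Lp_rep U = (SOME u. u \<in> U)"

definition Lp_add :: "real \<Rightarrow> 'a measure \<Rightarrow> ('a \<Rightarrow> 'e::{banach, second_countable_topology}) set
    \<Rightarrow> ('a \<Rightarrow> 'e) set \<Rightarrow> ('a \<Rightarrow> 'e) set" where
  "Lp_add p \<mu> U W = Lp_class p \<mu> (\<lambda>t. Lp_rep U t + Lp_rep W t)"

definition Lp_scale :: "real \<Rightarrow> 'a measure \<Rightarrow> real
    \<Rightarrow> ('a \<Rightarrow> 'e::{banach, second_countable_topology}) set \<Rightarrow> ('a \<Rightarrow> 'e) set" where
  "Lp_scale p \<mu> a U = Lp_class p \<mu> (\<lambda>t. a *\<^sub>R Lp_rep U t)"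

definition Lp_norm :: "real \<Rightarrow> 'a measure
    \<Rightarrow> ('a \<Rightarrow> 'e::{banach, second_countable_topology}) set \<Rightarrow> real" where
  "Lp_norm p \<mu> U = (\<integral>t. norm (Lp_rep U t) powr p \<partial>\<mu>) powr (1 / p)"

definition Lp_dist :: "real \<Rightarrow> 'a measure
    \<Rightarrow> ('a \<Rightarrow> 'e::{banach, second_countable_topology}) set \<Rightarrow> ('a \<Rightarrow> 'e) set \<Rightarrow> real" where
  "Lp_dist p \<mu> U W = Lp_norm p \<mu> (Lp_add p \<mu> U (Lp_scale p \<mu> (-1) W))"

definition Lp_dual :: "real \<Rightarrow> 'a measure
    \<Rightarrow> (('a \<Rightarrow> 'e::{banach, second_countable_topology}) set \<Rightarrow> real) set" where
  "Lp_dual p \<mu> = {\<Psi>.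
     (\<forall>U\<in>Lp_space p \<mu>. \<forall>W\<in>Lp_space p \<mu>. \<Psi> (Lp_add p \<mu> U W) = \<Psi> U + \<Psi> W) \<and>
     (\<forall>a. \<forall>U\<in>Lp_space p \<mu>. \<Psi> (Lp_scale p \<mu> a U) = a * \<Psi> U) \<and>
     (\<forall>U\<in>Lp_space p \<mu>. \<forall>\<epsilon>>0. \<exists>\<delta>>0. \<forall>W\<in>Lp_space p \<mu>.
        Lp_dist p \<mu> W U < \<delta> \<longrightarrow> \<bar>\<Psi> W - \<Psi> U\<bar> < \<epsilon>)}"

definition Lp_dual_norm :: "real \<Rightarrow> 'a measure
    \<Rightarrow> (('a \<Rightarrow> 'e::{banach, second_countable_topology}) set \<Rightarrow> real) \<Rightarrow> real" where
  "Lp_dual_norm p \<mu> \<Psi> = (SUP U\<in>{U \<in> Lp_space p \<mu>. Lp_norm p \<mu> U \<le> 1}. \<bar>\<Psi> U\<bar>)"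

definition Caratheodory :: "'a measure
    \<Rightarrow> ('a \<Rightarrow> 'e::{banach, second_countable_topology} \<Rightarrow> real) \<Rightarrow> bool" where
  "Caratheodory \<mu> g \<longleftrightarrow>
     (\<forall>x. (\<lambda>t. g t x) \<in> borel_measurable \<mu>) \<and> (\<forall>t\<in>space \<mu>. continuous_on UNIV (g t))"

definition J :: "'a measure \<Rightarrow> ('a \<Rightarrow> 'e::{banach, second_countable_topology} \<Rightarrow> real)
    \<Rightarrow> ('a \<Rightarrow> 'e) set \<Rightarrow> real" where
  "J \<mu> g U = (\<integral>t. g t (Lp_rep U t) \<partial>\<mu>)"

definition A_class :: "real \<Rightarrow> 'a measure
    \<Rightarrow> ('a \<Rightarrow> 'e::{banach, second_countable_topology} \<Rightarrow> real) set" where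
  "A_class p \<mu> = {g. Caratheodory \<mu> g \<and> (\<forall>u\<in>Lp_fun p \<mu>. integrable \<mu> (\<lambda>t. g t (u t)))}"

definition V_family :: "real \<Rightarrow> 'a measure
    \<Rightarrow> ('a \<Rightarrow> 'e::{banach, second_countable_topology}) set set set" where
  "V_family p \<mu> = {V. \<exists>\<Psi>\<in>Lp_dual p \<mu>. \<exists>g\<in>A_class p \<mu>.
     (\<exists>L\<ge>0. L < Lp_dual_norm p \<mu> \<Psi> \<and>
        (\<forall>U\<in>Lp_space p \<mu>. \<forall>W\<in>Lp_space p \<mu>. \<bar>J \<mu> g U - J \<mu> g W\<bar> \<le> L * Lp_dist p \<mu> U W)) \<and>
     V = {U \<in> Lp_space p \<mu>. \<Psi> U = J \<mu> g U}}"

definition no_global_extrema :: "('e \<Rightarrow> real) \<Rightarrow> bool" where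
  "no_global_extrema h \<longleftrightarrow> \<not> (\<exists>x. \<forall>y. h x \<le> h y) \<and> \<not> (\<exists>x. \<forall>y. h y \<le> h x)"

lemma Lp_eq_equiv: "equiv (Lp_fun p \<mu>) (Lp_eq p \<mu>)"
proof (rule equivI)
  show "Lp_eq p \<mu> \<subseteq> Lp_fun p \<mu> \<times> Lp_fun p \<mu>" "refl_on (Lp_fun p \<mu>) (Lp_eq p \<mu>)" "sym (Lp_eq p \<mu>)"
    by (auto simp: Lp_eq_def refl_on_def sym_def eq_commute)
  show "trans (Lp_eq p \<mu>)"
    unfolding trans_def Lp_eq_def by (auto elim: AE_mp)
qed

lemma Lp_class_in_space: "u \<in> Lp_fun p \<mu> \<Longrightarrow> Lp_class p \<mu> u \<in> Lp_space p \<mu>"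
  by (simp add: Lp_class_def Lp_space_def quotientI)

lemma Lp_class_eq:
  assumes "u \<in> Lp_fun p \<mu>" "v \<in> Lp_fun p \<mu>" "AE t in \<mu>. u t = v t"
  shows "Lp_class p \<mu> u = Lp_class p \<mu> v"
  using assms equiv_class_eq[OF Lp_eq_equiv] by (fastforce simp: Lp_class_def Lp_eq_def)

lemma Lp_rep_class:
  assumes "u \<in> Lp_fun p \<mu>"
  shows "Lp_rep (Lp_class p \<mu> u) \<in> Lp_fun p \<mu>" "AE t in \<mu>. Lp_rep (Lp_class p \<mu> u) t = u t"
proof -
  have "u \<in> Lp_class p \<mu> u"
    using assms by (simp add: Lp_class_def Lp_eq_def)
  then have "Lp_rep (Lp_class p \<mu> u) \<in> Lp_class p \<mu> u"
    unfolding Lp_rep_def by (rule someI[of "\<lambda>v. v \<in> Lp_class p \<mu> u"])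
  then show "Lp_rep (Lp_class p \<mu> u) \<in> Lp_fun p \<mu>" "AE t in \<mu>. Lp_rep (Lp_class p \<mu> u) t = u t"
    by (auto simp: Lp_class_def Lp_eq_def eq_commute)
qed

lemma Lp_fun_scale:
  assumes "u \<in> Lp_fun p \<mu>"
  shows "(\<lambda>t. a *\<^sub>R u t) \<in> Lp_fun p \<mu>"
  using assms by (auto simp: Lp_fun_def powr_mult)

lemma Lp_fun_add:
  assumes "0 \<le> p" "u \<in> Lp_fun p \<mu>" "v \<in> Lp_fun p \<mu>"
  shows "(\<lambda>t. u t + v t) \<in> Lp_fun p \<mu>"
proof -
  have [measurable]: "u \<in> borel_measurable \<mu>" "v \<in> borel_measurable \<mu>"
    and int: "integrable \<mu> (\<lambda>t. norm (u t) powr p)" "integrable \<mu> (\<lambda>t. norm (v t) powr p)"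
    using assms by (auto simp: Lp_fun_def)
  have bound: "norm (x + y) powr p \<le> 2 powr p * (norm x powr p + norm y powr p)" for x y :: 'b
  proof -
    have "norm (x + y) powr p \<le> (2 * max (norm x) (norm y)) powr p"
      using assms(1) norm_triangle_ineq[of x y] by (intro powr_mono2) auto
    also have "\<dots> = 2 powr p * max (norm x) (norm y) powr p"
      by (rule powr_mult)
    also have "\<dots> \<le> 2 powr p * (norm x powr p + norm y powr p)"
      by (intro mult_left_mono) (auto simp: max_def)
    finally show ?thesis .
  qed
  have "integrable \<mu> (\<lambda>t. norm (u t + v t) powr p)"
  proof (rule Bochner_Integration.integrable_bound)
    show "integrable \<mu> (\<lambda>t. 2 powr p * (norm (u t) powr p + norm (v t) powr p))"
      using int by simp
    show "AE t in \<mu>. norm (norm (u t + v t) powr p)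
        \<le> norm (2 powr p * (norm (u t) powr p + norm (v t) powr p))"
      using bound by (auto intro!: AE_I2)
  qed simp
  then show ?thesis by (simp add: Lp_fun_def)
qed

lemma Lp_add_class:
  assumes "0 \<le> p" "u \<in> Lp_fun p \<mu>" "v \<in> Lp_fun p \<mu>"
  shows "Lp_add p \<mu> (Lp_class p \<mu> u) (Lp_class p \<mu> v) = Lp_class p \<mu> (\<lambda>t. u t + v t)"
  unfolding Lp_add_def
proof (rule Lp_class_eq)
  show "AE t in \<mu>. Lp_rep (Lp_class p \<mu> u) t + Lp_rep (Lp_class p \<mu> v) t = u t + v t"
    using Lp_rep_class(2)[OF assms(2)] Lp_rep_class(2)[OF assms(3)] by eventually_elim simp
qed (intro Lp_fun_add Lp_rep_class assms)+

lemma Lp_scale_class: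
  assumes "u \<in> Lp_fun p \<mu>"
  shows "Lp_scale p \<mu> a (Lp_class p \<mu> u) = Lp_class p \<mu> (\<lambda>t. a *\<^sub>R u t)"
  unfolding Lp_scale_def
proof (rule Lp_class_eq)
  show "AE t in \<mu>. a *\<^sub>R Lp_rep (Lp_class p \<mu> u) t = a *\<^sub>R u t"
    using Lp_rep_class(2)[OF assms] by eventually_elim simp
qed (intro Lp_fun_scale Lp_rep_class assms)+

lemma Lp_norm_class:
  assumes "u \<in> Lp_fun p \<mu>"
  shows "Lp_norm p \<mu> (Lp_class p \<mu> u) = (\<integral>t. norm (u t) powr p \<partial>\<mu>) powr (1 / p)"
proof -
  have "(\<integral>t. norm (Lp_rep (Lp_class p \<mu> u) t) powr p \<partial>\<mu>) = (\<integral>t. norm (u t) powr p \<partial>\<mu>)"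
  proof (rule integral_cong_AE)
    show "AE t in \<mu>. norm (Lp_rep (Lp_class p \<mu> u) t) powr p = norm (u t) powr p"
      using Lp_rep_class(2)[OF assms] by eventually_elim simp
  qed (use assms Lp_rep_class(1)[OF assms] in \<open>auto simp: Lp_fun_def\<close>)
  then show ?thesis by (simp add: Lp_norm_def)
qed

lemma Lp_dist_class:
  assumes "0 \<le> p" "u \<in> Lp_fun p \<mu>" "v \<in> Lp_fun p \<mu>"
  shows "Lp_dist p \<mu> (Lp_class p \<mu> u) (Lp_class p \<mu> v)
    = (\<integral>t. norm (u t - v t) powr p \<partial>\<mu>) powr (1 / p)"
proof -
  have v: "(\<lambda>t. - v t) \<in> Lp_fun p \<mu>"
    using Lp_fun_scale[OF assms(3), of "-1"] by simp
  then show ?thesis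
    using assms Lp_fun_add[OF assms(1,2) v]
    by (simp add: Lp_dist_def Lp_scale_class Lp_add_class Lp_norm_class)
qed

lemma J_class:
  assumes "g \<in> A_class p \<mu>" "u \<in> Lp_fun p \<mu>"
  shows "J \<mu> g (Lp_class p \<mu> u) = (\<integral>t. g t (u t) \<partial>\<mu>)"
  unfolding J_def
proof (rule integral_cong_AE)
  show "AE t in \<mu>. g t (Lp_rep (Lp_class p \<mu> u) t) = g t (u t)"
    using Lp_rep_class(2)[OF assms(2)] by eventually_elim simp
qed (use assms Lp_rep_class(1)[OF assms(2)] in
      \<open>auto simp: A_class_def intro!: borel_measurable_integrable\<close>)

end

theory Submission
  imports Defs
begin

text \<open>
  Write \<open>I r u\<close> for \<open>\<integral> r(t, u(t)) d\<mu>\<close> and let \<open>V\<close> be the set \<open>\<Psi> u = I g u\<close>. The mechanism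
  behind the theorem is Lyapunov's convexity theorem, which allows two functions to be
  spliced: given \<open>u, w\<close> in \<open>L\<^sup>p\<close>, a share \<open>\<tau> \<in> [0, 1]\<close> and finitely many integral
  functionals, there is a measurable set \<open>A\<close> such that the function equal to \<open>w\<close> on \<open>A\<close> and
  to \<open>u\<close> elsewhere has, for \<open>\<Psi>\<close> and for each of these functionals \<open>I r\<close>, exactly the value
  that lies at the fraction \<open>\<tau>\<close> of the way from the value at \<open>u\<close> to the value at \<open>w\<close>
  (\<open>proportional_splice\<close>). For \<open>\<Psi>\<close> this rests on the fact that \<open>A \<mapsto> \<Psi> ((w - u) 1\<^sub>A)\<close> is
  itself an additive, absolutely continuous set function, to which Lyapunov's theorem
  applies directly. In particular a splice of two elements of \<open>V\<close> by such a set \<open>A\<close> stays in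
  \<open>V\<close>, although \<open>V\<close> need not be convex.

  The key point is that \<open>I f\<close> has no local extremum on \<open>V\<close>
  (\<open>no_local_minimum_on_constraint\<close>). Let \<open>u \<in> V\<close>. Since \<open>f(t, \<cdot>)\<close> has no minimum for
  \<open>t \<in> D\<close>, replacing \<open>u\<close> by a suitable constant on a suitable piece of \<open>D\<close> lowers \<open>I f\<close>
  (\<open>lowered_by_constant\<close>), but may leave \<open>V\<close>. The constraint is then repaired at arbitrarily
  small cost: the hypothesis on the Lipschitz constant supplies a direction \<open>v\<close> along which
  \<open>\<Psi> - I g\<close> grows at least linearly; a huge multiple of \<open>v\<close>, spliced in with a tiny share,
  changes \<open>\<Psi> - I g\<close> by the required amount, while \<open>I f\<close> changes by at most twice the
  integral of the dominating function \<open>M\<close> over a set that carries a tiny share of that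
  integral. This yields \<open>w \<in> V\<close> with \<open>I f w < I f u\<close>, possibly far from \<open>u\<close>
  (\<open>constraint_repaired_cheaply\<close>). Splicing a small share of \<open>w\<close> into \<open>u\<close> gives such points
  of \<open>V\<close> arbitrarily close to \<open>u\<close>. The same argument for \<open>-f\<close> excludes local maxima.

  Consequently there are \<open>v, w \<in> V\<close> arbitrarily close to \<open>u\<close> with \<open>I f v < I f u < I f w\<close>.
  By dominated convergence \<open>I f\<^sub>n v < \<lambda>\<^sub>n < I f\<^sub>n w\<close> for large \<open>n\<close>, and one more splice of
  \<open>v\<close> and \<open>w\<close> produces a point of \<open>V\<close> near \<open>u\<close> at which \<open>I f\<^sub>n\<close> equals \<open>\<lambda>\<^sub>n\<close>.
\<close>

section \<open>Lyapunov's convexity theorem\<close>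

text \<open>
  A charge is a signed, finitely additive set function. Absolute continuity is put in the
  \<open>\<epsilon>\<close>-\<open>\<delta>\<close> form because this yields countable additivity and can be read off directly for the
  set functions considered below.
\<close>

definition ac_charge :: "'a measure \<Rightarrow> ('a set \<Rightarrow> real) \<Rightarrow> bool" where
  "ac_charge N m \<longleftrightarrow>
     (\<forall>A\<in>sets N. \<forall>B\<in>sets N. A \<inter> B = {} \<longrightarrow> m (A \<union> B) = m A + m B) \<and>
     (\<forall>\<epsilon>>0. \<exists>\<delta>>0. \<forall>A\<in>sets N. measure N A < \<delta> \<longrightarrow> \<bar>m A\<bar> < \<epsilon>)"

lemma ac_charge_Un:
  assumes "ac_charge N m" "A \<in> sets N" "B \<in> sets N" "A \<inter> B = {}"
  shows "m (A \<union> B) = m A + m B"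
  using assms unfolding ac_charge_def by blast

lemma ac_charge_Diff:
  assumes "ac_charge N m" "A \<in> sets N" "B \<in> sets N" "B \<subseteq> A"
  shows "m (A - B) = m A - m B"
proof -
  have "m (B \<union> (A - B)) = m B + m (A - B)"
    using assms by (intro ac_charge_Un[OF assms(1)]) auto
  moreover have "B \<union> (A - B) = A" using assms by auto
  ultimately show ?thesis by simp
qed

lemma (in finite_measure) ac_charge_measure: "ac_charge M (measure M)"
  unfolding ac_charge_def by (auto simp: finite_measure_Union intro!: exI)

locale nonatomic_finite_measure = finite_measure N for N :: "'a measure" +
  assumes nonatomic: "non_atomic N"
begin

lemma split_positive:
  assumes "A \<in> sets N" "0 < measure N A"
  obtains B where "B \<in> sets N" "B \<subseteq> A" "0 < measure N B" "measure N B < measure N A"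
proof -
  have "0 < emeasure N A" using assms by (simp add: emeasure_eq_measure)
  then obtain B where "B \<in> sets N" "B \<subseteq> A" "0 < emeasure N B" "emeasure N B < emeasure N A"
    using nonatomic assms(1) unfolding non_atomic_def by blast
  then show ?thesis using that by (simp add: emeasure_eq_measure ennreal_less_iff)
qed

lemma positive_subset_at_most_half:
  assumes "A \<in> sets N" "0 < measure N A"
  shows "\<exists>B\<in>sets N. B \<subseteq> A \<and> 0 < measure N B \<and> measure N B \<le> measure N A / 2"
proof -
  obtain B where B: "B \<in> sets N" "B \<subseteq> A" "0 < measure N B" "measure N B < measure N A"
    using split_positive[OF assms] .
  have d: "measure N (A - B) = measure N A - measure N B"
    using B assms(1) by (simp add: finite_measure_Diff)
  show ?thesis
  proof (cases "measure N B \<le> measure N A / 2")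
    case False
    then show ?thesis using B d assms(1) by (intro bexI[of _ "A - B"]) auto
  qed (use B in auto)
qed

text \<open>
  Halving repeatedly, always keeping a piece of positive measure, makes the measure small.
\<close>

lemma small_positive_subset:
  assumes "A \<in> sets N" "0 < measure N A" "0 < e"
  obtains B where "B \<in> sets N" "B \<subseteq> A" "0 < measure N B" "measure N B < e"
proof -
  have *: "\<exists>B\<in>sets N. B \<subseteq> A \<and> 0 < measure N B \<and> measure N B \<le> measure N A / 2 ^ n" for n
  proof (induction n)
    case (Suc n)
    then obtain B where B: "B \<in> sets N" "B \<subseteq> A" "0 < measure N B"
      "measure N B \<le> measure N A / 2 ^ n" by blast
    obtain C where "C \<in> sets N" "C \<subseteq> B" "0 < measure N C" "measure N C \<le> measure N B / 2"
      using positive_subset_at_most_half B by blast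
    then show ?case using B by (intro bexI[of _ C]) auto
  qed (use assms in auto)
  have "(\<lambda>n. measure N A * (1/2) ^ n) \<longlonglongrightarrow> measure N A * 0"
    by (intro tendsto_mult tendsto_const LIMSEQ_realpow_zero) auto
  then have "eventually (\<lambda>n. measure N A * (1/2) ^ n < e) sequentially"
    using assms(3) by (intro order_tendstoD(2)[of _ "measure N A * 0"]) auto
  then obtain n where "measure N A / 2 ^ n < e"
    by (auto simp: eventually_sequentially power_one_over)
  with *[of n] that show ?thesis by (meson le_less_trans)
qed

text \<open>
  Sierpinski's theorem, by greedy exhaustion: each step adds an admissible piece whose
  measure is at least half of the supremum of the admissible measures. The increments tend
  to 0, so in the limit no admissible piece of positive measure is left, whereas
  \<open>small_positive_subset\<close> would provide one if the target were missed.
\<close>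

lemma subset_of_measure:
  assumes A: "A \<in> sets N" and a: "0 \<le> a" "a \<le> measure N A"
  shows "\<exists>B\<in>sets N. B \<subseteq> A \<and> measure N B = a"
proof -
  define adm where "adm B = {C \<in> sets N. C \<subseteq> A - B \<and> measure N B + measure N C \<le> a}" for B
  define s where "s B = Sup (measure N ` adm B)" for B
  have bdd: "bdd_above (measure N ` adm B)" for B
    by (rule bdd_aboveI2[of _ _ "a"]) (auto simp: adm_def, smt (verit) measure_nonneg)
  have ex: "\<exists>C\<in>adm B. s B / 2 \<le> measure N C" if "measure N B \<le> a" for B
  proof (cases "s B \<le> 0")
    case True
    then show ?thesis using that by (intro bexI[of _ "{}"]) (auto simp: adm_def)
  next
    case False
    have "adm B \<noteq> {}" using that by (auto simp: adm_def intro!: exI[of _ "{}"])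
    then show ?thesis
      using False less_cSupD[of "measure N ` adm B" "s B / 2"] by (auto simp: s_def intro: less_imp_le)
  qed
  define ok where "ok B \<longleftrightarrow> B \<in> sets N \<and> B \<subseteq> A \<and> measure N B \<le> a" for B
  have "\<exists>B. \<forall>n. ok (B n) \<and> B n \<subseteq> B (Suc n) \<and> s (B n) / 2 \<le> measure N (B (Suc n)) - measure N (B n)"
  proof (rule dependent_nat_choice)
    show "\<exists>B. ok B" using a by (auto simp: ok_def intro!: exI[of _ "{}"])
  next
    fix B n assume "ok B"
    then obtain C where C: "C \<in> adm B" "s B / 2 \<le> measure N C" using ex by (auto simp: ok_def)
    have "measure N (B \<union> C) = measure N B + measure N C"
      using C \<open>ok B\<close> by (intro finite_measure_Union) (auto simp: adm_def ok_def)
    then show "\<exists>C. ok C \<and> B \<subseteq> C \<and> s B / 2 \<le> measure N C - measure N B"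
      using C \<open>ok B\<close> by (intro exI[of _ "B \<union> C"]) (auto simp: adm_def ok_def)
  qed
  then obtain B where B: "\<And>n. ok (B n)" "\<And>n. B n \<subseteq> B (Suc n)"
      "\<And>n. s (B n) / 2 \<le> measure N (B (Suc n)) - measure N (B n)" by blast
  let ?B = "\<Union>n. B n"
  have Bs: "?B \<in> sets N" "?B \<subseteq> A" using B(1) by (auto simp: ok_def)
  have lim: "(\<lambda>n. measure N (B n)) \<longlonglongrightarrow> measure N ?B"
    using B(1,2) by (intro finite_Lim_measure_incseq) (auto simp: ok_def incseq_Suc_iff)
  have le: "measure N ?B \<le> a"
    by (rule LIMSEQ_le_const2[OF lim]) (use B(1) in \<open>auto simp: ok_def\<close>)
  have "measure N ?B = a"
  proof (rule ccontr)
    assume "measure N ?B \<noteq> a"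
    with le have lt: "measure N ?B < a" by simp
    have "0 < measure N (A - ?B)"
      using Bs A lt a by (simp add: finite_measure_Diff)
    then obtain D where D: "D \<in> sets N" "D \<subseteq> A - ?B" "0 < measure N D"
        "measure N D < a - measure N ?B"
      using small_positive_subset[of "A - ?B" "a - measure N ?B"] lt A Bs by auto
    have "measure N D \<le> s (B n)" for n
    proof -
      have "measure N (B n) \<le> measure N ?B"
        using Bs by (intro finite_measure_mono) auto
      then have "D \<in> adm (B n)" using D by (auto simp: adm_def)
      then show ?thesis unfolding s_def by (intro cSup_upper bdd) auto
    qed
    then have ge: "measure N D / 2 \<le> measure N (B (Suc n)) - measure N (B n)" for n
      using B(3)[of n] by (smt (verit) divide_right_mono)
    have "(\<lambda>n. measure N (B (Suc n)) - measure N (B n)) \<longlonglongrightarrow> measure N ?B - measure N ?B"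
      by (intro tendsto_diff lim LIMSEQ_Suc[OF lim])
    then have "measure N D / 2 \<le> measure N ?B - measure N ?B"
      by (rule LIMSEQ_le_const) (use ge in auto)
    with D show False by simp
  qed
  with Bs show ?thesis by blast
qed

text \<open>
  The conclusion of Lyapunov's theorem in the strong form that can be proved by induction on
  the number of charges: the sets of the prescribed shares can be chosen increasing in the
  share.
\<close>

definition uniformly_splittable :: "('a set \<Rightarrow> real) set \<Rightarrow> bool" where
  "uniformly_splittable F \<longleftrightarrow> (\<forall>A\<in>sets N. \<exists>E :: real \<Rightarrow> 'a set.
     E 0 = {} \<and> E 1 = A \<and> (\<forall>s t. s \<le> t \<longrightarrow> E s \<subseteq> E t) \<and>
     (\<forall>t\<in>{0..1}. E t \<in> sets N \<and> (\<forall>m\<in>F. m (E t) = t * m A)))"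

lemma charge_tendsto_incseq_Union:
  assumes "ac_charge N m" "range G \<subseteq> sets N" "incseq G"
  shows "(\<lambda>n. m (G n)) \<longlonglongrightarrow> m (\<Union>n. G n)"
proof (rule LIMSEQ_I)
  fix e :: real assume "0 < e"
  then obtain d where d: "d > 0" "\<And>A. A \<in> sets N \<Longrightarrow> measure N A < d \<Longrightarrow> \<bar>m A\<bar> < e"
    using assms(1) unfolding ac_charge_def by meson
  have U: "(\<Union>n. G n) \<in> sets N" using assms(2) by auto
  have "(\<lambda>n. measure N (G n)) \<longlonglongrightarrow> measure N (\<Union>n. G n)"
    using assms by (intro finite_Lim_measure_incseq)
  then obtain n0 where n0: "\<And>n. n \<ge> n0 \<Longrightarrow> \<bar>measure N (G n) - measure N (\<Union>n. G n)\<bar> < d"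
    using LIMSEQ_D[of _ _ d] d(1) by (metis real_norm_def)
  have "norm (m (G n) - m (\<Union>n. G n)) < e" if "n \<ge> n0" for n
  proof -
    have Gn: "G n \<in> sets N" "G n \<subseteq> (\<Union>n. G n)" using assms(2) by auto
    have "measure N ((\<Union>n. G n) - G n) = measure N (\<Union>n. G n) - measure N (G n)"
      using Gn U by (simp add: finite_measure_Diff)
    then have "\<bar>m ((\<Union>n. G n) - G n)\<bar> < e"
      using n0[OF that] d(2)[of "(\<Union>n. G n) - G n"] Gn U by auto
    then show ?thesis using ac_charge_Diff[OF assms(1) U Gn] by simp
  qed
  then show "\<exists>no. \<forall>n\<ge>no. norm (m (G n) - m (\<Union>n. G n)) < e" by blast
qed

text \<open>
  Iterated halving cuts a set into \<open>2\<^sup>n\<close> consecutive pieces of equal charge. The set of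
  share \<open>t\<close> is the limit of the unions of the first \<open>\<lfloor>2\<^sup>n t\<rfloor>\<close> pieces.
\<close>

lemma splittable_if_halving:
  assumes ac: "\<And>m. m \<in> F \<Longrightarrow> ac_charge N m"
    and halving: "\<And>A. A \<in> sets N \<Longrightarrow> \<exists>B\<in>sets N. B \<subseteq> A \<and> (\<forall>m\<in>F. m B = m A / 2)"
  shows "uniformly_splittable F"
  unfolding uniformly_splittable_def
proof
  fix A assume A: "A \<in> sets N"
  obtain half where half: "\<And>A. A \<in> sets N \<Longrightarrow> half A \<in> sets N \<and> half A \<subseteq> A \<and> (\<forall>m\<in>F. m (half A) = m A / 2)"
    using halving by metis
  \<comment> \<open>\<open>G n j\<close> is the union of the first \<open>j\<close> of the \<open>2\<^sup>n\<close> pieces of generation \<open>n\<close>.\<close>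
  define G where "G = rec_nat (\<lambda>j::nat. if j = 0 then {} else A)
    (\<lambda>n g j. if even j then g (j div 2)
       else g (j div 2) \<union> half (g (Suc (j div 2)) - g (j div 2)))"
  have G0: "G 0 j = (if j = 0 then {} else A)" for j by (simp add: G_def)
  have GS: "G (Suc n) j = (if even j then G n (j div 2)
       else G n (j div 2) \<union> half (G n (Suc (j div 2)) - G n (j div 2)))" for n j
    by (simp add: G_def)
  have G_sets: "G n j \<in> sets N" for n j
    using A half by (induction n arbitrary: j) (auto simp: G0 GS)
  have G_step: "G n j \<subseteq> G n (Suc j)" for n j
  proof (induction n arbitrary: j)
    case (Suc n)
    show ?case
    proof (cases "even j")
      case False
      then obtain i where "j = Suc (2 * i)" by (metis oddE Suc_eq_plus1)
      then show ?thesis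
        using half[of "G n (Suc i) - G n i"] G_sets Suc[of i] by (auto simp: GS)
    qed (auto simp: GS)
  qed (simp add: G0)
  have G_mono: "i \<le> j \<Longrightarrow> G n i \<subseteq> G n j" for n i j
    using G_step[of n] by (rule lift_Suc_mono_le)
  have G_refine: "G (Suc n) (2 * j) = G n j" for n j by (simp add: GS)
  have G_empty: "G n 0 = {}" for n by (induction n) (auto simp: G0 GS)
  have G_full: "G n (2 ^ n) = A" for n by (induction n) (auto simp: G0 GS)
  have m_empty: "m {} = 0" if "m \<in> F" for m
    using ac_charge_Diff[OF ac[OF that] A A] by simp
  have G_m: "m (G n j) = real j / 2 ^ n * m A" if "m \<in> F" "j \<le> 2 ^ n" for m n j
    using that(2)
  proof (induction n arbitrary: j)
    case 0
    then have "j = 0 \<or> j = 1" by auto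
    then show ?case by (auto simp: G0 m_empty that)
  next
    case (Suc n)
    show ?case
    proof (cases "even j")
      case True
      then show ?thesis using Suc by (auto simp: GS elim!: evenE)
    next
      case False
      then obtain i where i: "j = Suc (2 * i)" by (metis oddE Suc_eq_plus1)
      let ?H = "half (G n (Suc i) - G n i)"
      have H: "?H \<in> sets N" "?H \<subseteq> G n (Suc i) - G n i" "m ?H = m (G n (Suc i) - G n i) / 2"
        using half[of "G n (Suc i) - G n i"] G_sets that by auto
      have le: "Suc i \<le> 2 ^ n" using Suc.prems i by auto
      have "m (G n i \<union> ?H) = m (G n i) + m ?H"
        using H G_sets by (intro ac_charge_Un[OF ac[OF that(1)]]) auto
      also have "\<dots> = m (G n i) + (m (G n (Suc i)) - m (G n i)) / 2"
        using ac_charge_Diff[OF ac[OF that(1)] G_sets G_sets G_step] H by simp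
      also have "\<dots> = real j / 2 ^ Suc n * m A"
        using Suc.IH[of i] Suc.IH[of "Suc i"] le i by (simp add: field_simps)
      finally show ?thesis using False i by (simp add: GS)
    qed
  qed
  define k where "k t n = nat \<lfloor>2 ^ n * t\<rfloor>" for t :: real and n
  define E where "E t = (\<Union>n. G n (k t n))" for t
  have k0: "k 0 n = 0" and k1: "k 1 n = 2 ^ n" for n
    by (auto simp: k_def nat_power_eq)
  have mono: "E s \<subseteq> E t" if "s \<le> t" for s t
  proof -
    have "k s n \<le> k t n" for n using that by (auto simp: k_def intro!: nat_mono floor_mono)
    then show ?thesis unfolding E_def using G_mono by blast
  qed
  have val: "m (E t) = t * m A" if "m \<in> F" "t \<in> {0..1}" for m t
  proof -
    have inc: "incseq (\<lambda>n. G n (k t n))"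
    proof (rule incseq_SucI)
      fix n
      have "2 * k t n \<le> k t (Suc n)"
      proof -
        have "2 * \<lfloor>2 ^ n * t\<rfloor> \<le> \<lfloor>2 ^ Suc n * t\<rfloor>" by (simp add: le_floor_iff)
        then show ?thesis using that(2) by (auto simp: k_def nat_le_iff nat_mult_distrib)
      qed
      then show "G n (k t n) \<subseteq> G (Suc n) (k t (Suc n))"
        using G_mono[of "2 * k t n" "k t (Suc n)" "Suc n"] by (simp add: G_refine)
    qed
    have kreal: "real (k t n) = of_int \<lfloor>2 ^ n * t\<rfloor>" for n using that(2) by (simp add: k_def)
    have kle: "k t n \<le> 2 ^ n" for n
    proof -
      have "real (k t n) \<le> 2 ^ n * t" by (simp add: kreal)
      also have "\<dots> \<le> 2 ^ n" using that(2) by simp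
      finally have "real (k t n) \<le> real (2 ^ n)" by simp
      then show ?thesis by (simp only: of_nat_le_iff)
    qed
    have "(\<lambda>n. m (G n (k t n))) \<longlonglongrightarrow> m (E t)"
      unfolding E_def using inc G_sets by (intro charge_tendsto_incseq_Union ac that) auto
    moreover have "(\<lambda>n. m (G n (k t n))) \<longlonglongrightarrow> t * m A"
    proof -
      have "(\<lambda>n. real (k t n) / 2 ^ n) \<longlonglongrightarrow> t"
      proof (rule tendsto_sandwich[of "\<lambda>n. t - (1/2) ^ n" _ _ "\<lambda>_. t"])
        have "(\<lambda>n. t - (1/2) ^ n) \<longlonglongrightarrow> t - 0"
          by (intro tendsto_diff tendsto_const LIMSEQ_realpow_zero) auto
        then show "(\<lambda>n. t - (1/2) ^ n) \<longlonglongrightarrow> t" by simp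
        show "\<forall>\<^sub>F n in sequentially. t - (1 / 2) ^ n \<le> real (k t n) / 2 ^ n"
        proof (intro always_eventually allI)
          fix n
          have "2 ^ n * t - 1 \<le> real (k t n)" unfolding kreal by linarith
          then show "t - (1 / 2) ^ n \<le> real (k t n) / 2 ^ n"
            by (simp add: pos_le_divide_eq left_diff_distrib power_one_over mult.commute[of "2 ^ n"])
        qed
        show "\<forall>\<^sub>F n in sequentially. real (k t n) / 2 ^ n \<le> t"
          by (intro always_eventually allI) (simp add: kreal pos_divide_le_eq mult.commute[of t])
      qed simp
      then have "(\<lambda>n. real (k t n) / 2 ^ n * m A) \<longlonglongrightarrow> t * m A" by (rule tendsto_mult_right)
      then show ?thesis using G_m[OF that(1) kle] by simp
    qed
    ultimately show ?thesis by (rule LIMSEQ_unique)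
  qed
  have "E 0 = {}" "E 1 = A" by (auto simp: E_def k0 k1 G_empty G_full)
  moreover have "E t \<in> sets N" for t unfolding E_def using G_sets by auto
  ultimately show "\<exists>E. E 0 = {} \<and> E 1 = A \<and> (\<forall>s t. s \<le> t \<longrightarrow> E s \<subseteq> E t) \<and>
     (\<forall>t\<in>{0..1}. E t \<in> sets N \<and> (\<forall>m\<in>F. m (E t) = t * m A))"
    using mono val by blast
qed

text \<open>
  The induction step of Ross's elementary proof of Lyapunov's theorem. The strip
  \<open>E (s + 1/2) - E s\<close> has half of every old charge, for each \<open>s\<close> in \<open>[0, 1/2]\<close>. The strips
  for \<open>s = 0\<close> and \<open>s = 1/2\<close> are complementary, so their new charges average to half of the
  total; by the intermediate value theorem some strip in between has exactly half. The
  measure itself is among the old charges, which makes the new charge of \<open>E t\<close> continuous in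
  \<open>t\<close>.
\<close>

lemma halving_insert:
  assumes split: "uniformly_splittable F" and N: "measure N \<in> F"
    and ac: "\<And>m. m \<in> insert m0 F \<Longrightarrow> ac_charge N m" and A: "A \<in> sets N"
  shows "\<exists>B\<in>sets N. B \<subseteq> A \<and> (\<forall>m\<in>insert m0 F. m B = m A / 2)"
proof -
  obtain E where E: "E 0 = {}" "E 1 = A" "\<And>s t. s \<le> t \<Longrightarrow> E s \<subseteq> E t"
     "\<And>t. 0 \<le> t \<Longrightarrow> t \<le> 1 \<Longrightarrow> E t \<in> sets N" "\<And>t m. 0 \<le> t \<Longrightarrow> t \<le> 1 \<Longrightarrow> m \<in> F \<Longrightarrow> m (E t) = t * m A"
    using split A unfolding uniformly_splittable_def by (metis atLeastAtMost_iff)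
  have diff: "m (E t - E s) = m (E t) - m (E s)"
    if "m \<in> insert m0 F" "0 \<le> s" "s \<le> t" "t \<le> 1" for m s t
    using that E by (intro ac_charge_Diff[OF ac]) auto
  have cont: "continuous_on {0..1} (\<lambda>t. m0 (E t))"
    unfolding continuous_on_iff
  proof (intro ballI allI impI)
    fix x e :: real assume x: "x \<in> {0..1}" and e: "0 < e"
    then obtain d where d: "d > 0" "\<And>A. A \<in> sets N \<Longrightarrow> measure N A < d \<Longrightarrow> \<bar>m0 A\<bar> < e"
      using ac[of m0] unfolding ac_charge_def by (metis insertI1)
    define d' where "d' = d / (measure N A + 1)"
    have pos: "measure N A + 1 > 0" by (smt (verit) measure_nonneg)
    then have d': "d' > 0" using d by (simp add: d'_def)
    have key: "\<bar>m0 (E t) - m0 (E s)\<bar> < e" if "0 \<le> s" "s \<le> t" "t \<le> 1" "t - s < d'" for s t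
    proof -
      have "measure N (E t - E s) = (t - s) * measure N A"
        using diff[of "measure N" s t] N E(5) that by (simp add: algebra_simps)
      also have "\<dots> \<le> (t - s) * (measure N A + 1)" using that by (intro mult_left_mono) auto
      also have "\<dots> < d" using that pos by (simp add: d'_def field_simps)
      finally have "\<bar>m0 (E t - E s)\<bar> < e" using E that by (intro d(2)) auto
      then show ?thesis using diff[of m0 s t] that by simp
    qed
    show "\<exists>d>0. \<forall>y\<in>{0..1}. dist y x < d \<longrightarrow> dist (m0 (E y)) (m0 (E x)) < e"
    proof (intro exI[of _ d'] conjI ballI impI d')
      fix y assume y: "y \<in> {0..1}" "dist y x < d'"
      then show "dist (m0 (E y)) (m0 (E x)) < e"
        using key[of x y] key[of y x] x by (cases "x \<le> y") (auto simp: dist_real_def)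
    qed
  qed
  define \<phi> where "\<phi> s = m0 (E (s + 1/2)) - m0 (E s)" for s
  have cont\<phi>: "continuous_on {0..1/2} \<phi>"
    unfolding \<phi>_def
    by (intro continuous_on_diff continuous_on_compose2[OF cont] continuous_intros) auto
  have m_empty: "m0 {} = 0" using diff[of m0 0 0] by simp
  have "\<phi> 0 + \<phi> (1/2) = m0 A" using E m_empty by (simp add: \<phi>_def)
  then have "\<exists>s\<ge>0. s \<le> 1/2 \<and> \<phi> s = m0 A / 2"
  proof (cases "\<phi> 0 \<le> m0 A / 2")
    case True
    then show ?thesis using \<open>\<phi> 0 + \<phi> (1/2) = m0 A\<close> cont\<phi> by (intro IVT') auto
  next
    case False
    then show ?thesis using \<open>\<phi> 0 + \<phi> (1/2) = m0 A\<close> cont\<phi> by (intro IVT2') auto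
  qed
  then obtain s where s: "0 \<le> s" "s \<le> 1/2" "\<phi> s = m0 A / 2" by blast
  show ?thesis
  proof (intro bexI[of _ "E (s + 1/2) - E s"] conjI ballI)
    show "E (s + 1/2) - E s \<subseteq> A" using E(3)[of "s + 1/2" 1] E(2) s by auto
    show "E (s + 1/2) - E s \<in> sets N" using E(4) s by auto
    fix m assume m: "m \<in> insert m0 F"
    show "m (E (s + 1/2) - E s) = m A / 2"
    proof (cases "m = m0")
      case True
      then show ?thesis using diff[of m0 s "s + 1/2"] s by (simp add: \<phi>_def)
    next
      case False
      then show ?thesis using diff[OF m, of s "s + 1/2"] s m E(5)[of s m] E(5)[of "s + 1/2" m]
        by (simp add: algebra_simps)
    qed
  qed
qed

theorem Lyapunov_splittable:
  assumes "finite F" "\<And>m. m \<in> F \<Longrightarrow> ac_charge N m"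
  shows "uniformly_splittable (insert (measure N) F)"
  using assms
proof (induction F)
  case empty
  show ?case
  proof (rule splittable_if_halving)
    show "\<exists>B\<in>sets N. B \<subseteq> A \<and> (\<forall>m\<in>{measure N}. m B = m A / 2)" if "A \<in> sets N" for A
      using subset_of_measure[OF that, of "measure N A / 2"] by auto
  qed (auto simp: ac_charge_measure)
next
  case (insert m F)
  have "uniformly_splittable (insert m (insert (measure N) F))"
  proof (rule splittable_if_halving)
    show ac: "ac_charge N m'" if "m' \<in> insert m (insert (measure N) F)" for m'
      using that insert.prems ac_charge_measure by auto
    show "\<exists>B\<in>sets N. B \<subseteq> A \<and> (\<forall>m'\<in>insert m (insert (measure N) F). m' B = m' A / 2)"
      if "A \<in> sets N" for A
    proof (rule halving_insert[OF _ _ ac that])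
      show "uniformly_splittable (insert (measure N) F)"
        using insert.IH insert.prems by blast
    qed auto
  qed
  then show ?case by (simp add: insert_commute)
qed

corollary Lyapunov_subset:
  assumes "finite F" "\<And>m. m \<in> F \<Longrightarrow> ac_charge N m" "A \<in> sets N" "0 \<le> t" "t \<le> 1"
  shows "\<exists>B\<in>sets N. B \<subseteq> A \<and> (\<forall>m\<in>F. m B = t * m A)"
proof -
  obtain E where E: "E 1 = A" "\<And>s t. s \<le> t \<Longrightarrow> E s \<subseteq> E t"
    "\<And>t. t \<in> {0..1} \<Longrightarrow> E t \<in> sets N" "\<And>t m. t \<in> {0..1} \<Longrightarrow> m \<in> F \<Longrightarrow> m (E t) = t * m A"
    using Lyapunov_splittable[OF assms(1,2)] assms(3) unfolding uniformly_splittable_def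
    by (metis insertCI)
  show ?thesis
    using E(3,4)[of t] E(2)[of t 1] E(1) assms(4,5) by (intro bexI[of _ "E t"]) auto
qed

end

section \<open>Functionals on the Lebesgue space as charges\<close>

lemma Lp_fun_measurable [measurable_dest]: "u \<in> Lp_fun p \<mu> \<Longrightarrow> u \<in> borel_measurable \<mu>"
  by (simp add: Lp_fun_def)

lemma Lp_fun_integrable: "u \<in> Lp_fun p \<mu> \<Longrightarrow> integrable \<mu> (\<lambda>t. norm (u t) powr p)"
  by (simp add: Lp_fun_def)

lemma Lp_fun_diff:
  assumes "0 \<le> p" "u \<in> Lp_fun p \<mu>" "v \<in> Lp_fun p \<mu>"
  shows "(\<lambda>t. u t - v t) \<in> Lp_fun p \<mu>"
  using Lp_fun_add[OF assms(1,2) Lp_fun_scale[OF assms(3), of "-1"]] by simp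

lemma Lp_fun_restrict:
  assumes "u \<in> Lp_fun p \<mu>" "A \<in> sets \<mu>"
  shows "(\<lambda>t. indicator A t *\<^sub>R u t) \<in> Lp_fun p \<mu>"
proof -
  have [measurable]: "u \<in> borel_measurable \<mu>" "A \<in> sets \<mu>" using assms by (auto simp: Lp_fun_def)
  have "integrable \<mu> (\<lambda>t. norm (indicator A t *\<^sub>R u t) powr p)"
    by (rule Bochner_Integration.integrable_bound[OF Lp_fun_integrable[OF assms(1)]])
      (auto simp: indicator_def intro!: AE_I2)
  then show ?thesis by (simp add: Lp_fun_def)
qed

lemma integrable_indicator_mult:
  fixes \<phi> :: "'a \<Rightarrow> real"
  assumes "A \<in> sets \<mu>" "integrable \<mu> \<phi>"
  shows "integrable \<mu> (\<lambda>t. indicator A t * \<phi> t)"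
  using integrable_real_mult_indicator[OF assms] by (simp add: mult.commute)

text \<open>
  Approximate \<open>u\<close> by simple functions: the composition with a function of countable range is
  measurable, and continuity in the second variable carries this over to the limit.
\<close>

lemma Caratheodory_compose_measurable:
  assumes "Caratheodory \<mu> r" "u \<in> borel_measurable \<mu>"
  shows "(\<lambda>t. r t (u t)) \<in> borel_measurable \<mu>"
proof -
  obtain s where s: "\<And>i. simple_function \<mu> (s i)" "\<And>t. t \<in> space \<mu> \<Longrightarrow> (\<lambda>i. s i t) \<longlonglongrightarrow> u t"
    using borel_measurable_implies_sequence_metric[OF assms(2), of 0] by metis
  show ?thesis
  proof (rule borel_measurable_LIMSEQ_metric)
    fix i
    show "(\<lambda>t. r t (s i t)) \<in> borel_measurable \<mu>"
    proof (rule measurable_compose_countable'[where I = "s i ` space \<mu>"])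
      show "countable (s i ` space \<mu>)" using simple_functionD(1)[OF s(1)] by (rule countable_finite)
      show "s i \<in> measurable \<mu> (count_space (s i ` space \<mu>))"
        using s(1)[of i] by (subst measurable_count_space_eq2) (auto simp: simple_function_def)
    qed (use assms in \<open>auto simp: Caratheodory_def\<close>)
  next
    fix t assume t: "t \<in> space \<mu>"
    then have "isCont (r t) (u t)"
      using assms(1) by (auto simp: Caratheodory_def continuous_on_eq_continuous_at)
    then show "(\<lambda>i. r t (s i t)) \<longlonglongrightarrow> r t (u t)"
      using s(2)[OF t] by (rule isCont_tendsto_compose)
  qed
qed

lemma A_class_if_growth:
  assumes "Caratheodory \<mu> r" "integrable \<mu> M"
    and "AE t in \<mu>. \<forall>x. \<bar>r t x\<bar> \<le> M t + c * norm x powr p"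
  shows "r \<in> A_class p \<mu>"
proof -
  have "integrable \<mu> (\<lambda>t. r t (u t))" if "u \<in> Lp_fun p \<mu>" for u
  proof (rule Bochner_Integration.integrable_bound)
    show "integrable \<mu> (\<lambda>t. M t + c * norm (u t) powr p)"
      using assms(2) Lp_fun_integrable[OF that] by simp
    show "(\<lambda>t. r t (u t)) \<in> borel_measurable \<mu>"
      by (rule Caratheodory_compose_measurable[OF assms(1) Lp_fun_measurable[OF that]])
    show "AE t in \<mu>. norm (r t (u t)) \<le> norm (M t + c * norm (u t) powr p)"
      using assms(3)
    proof eventually_elim
      case (elim t)
      then have "\<bar>r t (u t)\<bar> \<le> M t + c * norm (u t) powr p" by blast
      then show ?case unfolding real_norm_def by linarith
    qed
  qed
  with assms(1) show ?thesis by (simp add: A_class_def)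
qed

text \<open>
  A continuous linear functional on the space of classes, seen as a functional on their
  representatives. Continuity at 0 is the form in which it yields absolute continuity of
  \<open>A \<mapsto> \<psi> (h 1\<^sub>A)\<close>.
\<close>

definition continuous_linear_on_Lp ::
    "real \<Rightarrow> 'a measure \<Rightarrow> (('a \<Rightarrow> 'e::{banach, second_countable_topology}) \<Rightarrow> real) \<Rightarrow> bool" where
  "continuous_linear_on_Lp p \<mu> \<psi> \<longleftrightarrow>
     (\<forall>u\<in>Lp_fun p \<mu>. \<forall>v\<in>Lp_fun p \<mu>. \<psi> (\<lambda>t. u t + v t) = \<psi> u + \<psi> v) \<and>
     (\<forall>a. \<forall>u\<in>Lp_fun p \<mu>. \<psi> (\<lambda>t. a *\<^sub>R u t) = a * \<psi> u) \<and>
     (\<forall>u\<in>Lp_fun p \<mu>. \<forall>v\<in>Lp_fun p \<mu>. (AE t in \<mu>. u t = v t) \<longrightarrow> \<psi> u = \<psi> v) \<and>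
     (\<forall>\<epsilon>>0. \<exists>\<delta>>0. \<forall>v\<in>Lp_fun p \<mu>. (\<integral>t. norm (v t) powr p \<partial>\<mu>) < \<delta> \<longrightarrow> \<bar>\<psi> v\<bar> < \<epsilon>)"

lemma
  assumes "continuous_linear_on_Lp p \<mu> \<psi>" "u \<in> Lp_fun p \<mu>"
  shows continuous_linear_add: "v \<in> Lp_fun p \<mu> \<Longrightarrow> \<psi> (\<lambda>t. u t + v t) = \<psi> u + \<psi> v"
    and continuous_linear_scale: "\<psi> (\<lambda>t. a *\<^sub>R u t) = a * \<psi> u"
    and continuous_linear_cong_AE:
      "v \<in> Lp_fun p \<mu> \<Longrightarrow> (AE t in \<mu>. u t = v t) \<Longrightarrow> \<psi> u = \<psi> v"
  using assms unfolding continuous_linear_on_Lp_def by metis+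

lemma Lp_dual_continuous_linear:
  fixes \<Psi> :: "('a \<Rightarrow> 'e::{banach, second_countable_topology}) set \<Rightarrow> real"
  assumes "0 < p" "\<Psi> \<in> Lp_dual p \<mu>"
  shows "continuous_linear_on_Lp p \<mu> (\<lambda>u. \<Psi> (Lp_class p \<mu> u))"
  unfolding continuous_linear_on_Lp_def
proof (intro conjI ballI allI impI)
  have add: "\<Psi> (Lp_add p \<mu> U W) = \<Psi> U + \<Psi> W" if "U \<in> Lp_space p \<mu>" "W \<in> Lp_space p \<mu>" for U W
    using assms(2) that by (simp add: Lp_dual_def)
  have scale: "\<Psi> (Lp_scale p \<mu> a U) = a * \<Psi> U" if "U \<in> Lp_space p \<mu>" for a U
    using assms(2) that by (simp add: Lp_dual_def)
  show "\<Psi> (Lp_class p \<mu> (\<lambda>t. u t + v t)) = \<Psi> (Lp_class p \<mu> u) + \<Psi> (Lp_class p \<mu> v)"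
    if "u \<in> Lp_fun p \<mu>" "v \<in> Lp_fun p \<mu>" for u v
    using add[OF that[THEN Lp_class_in_space]] that assms(1) by (simp add: Lp_add_class)
  show scale': "\<Psi> (Lp_class p \<mu> (\<lambda>t. a *\<^sub>R u t)) = a * \<Psi> (Lp_class p \<mu> u)"
    if "u \<in> Lp_fun p \<mu>" for a u
    using scale[OF Lp_class_in_space[OF that]] that by (simp add: Lp_scale_class)
  show "\<Psi> (Lp_class p \<mu> u) = \<Psi> (Lp_class p \<mu> v)"
    if "u \<in> Lp_fun p \<mu>" "v \<in> Lp_fun p \<mu>" "AE t in \<mu>. u t = v t" for u v
    using Lp_class_eq[OF that] by simp
  have zero: "(\<lambda>t. 0 :: 'e) \<in> Lp_fun p \<mu>" by (simp add: Lp_fun_def)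
  have \<Psi>0: "\<Psi> (Lp_class p \<mu> (\<lambda>t. 0 :: 'e)) = 0" using scale'[OF zero, of 0] by simp
  fix \<epsilon> :: real assume "0 < \<epsilon>"
  then obtain \<delta> where \<delta>: "\<delta> > 0" "\<And>W. W \<in> Lp_space p \<mu> \<Longrightarrow>
      Lp_dist p \<mu> W (Lp_class p \<mu> (\<lambda>t. 0 :: 'e)) < \<delta> \<Longrightarrow> \<bar>\<Psi> W - \<Psi> (Lp_class p \<mu> (\<lambda>t. 0 :: 'e))\<bar> < \<epsilon>"
    using assms(2) Lp_class_in_space[OF zero] unfolding Lp_dual_def by blast
  show "\<exists>\<delta>>0. \<forall>v\<in>Lp_fun p \<mu>. (\<integral>t. norm (v t) powr p \<partial>\<mu>) < \<delta> \<longrightarrow> \<bar>\<Psi> (Lp_class p \<mu> v)\<bar> < \<epsilon>"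
  proof (intro exI[of _ "\<delta> powr p"] conjI ballI impI)
    fix v :: "'a \<Rightarrow> 'e" assume v: "v \<in> Lp_fun p \<mu>" and lt: "(\<integral>t. norm (v t) powr p \<partial>\<mu>) < \<delta> powr p"
    have "(\<integral>t. norm (v t) powr p \<partial>\<mu>) powr (1 / p) < (\<delta> powr p) powr (1 / p)"
      using lt assms(1) by (intro powr_less_mono2) auto
    then have "Lp_dist p \<mu> (Lp_class p \<mu> v) (Lp_class p \<mu> (\<lambda>t. 0 :: 'e)) < \<delta>"
      using Lp_dist_class[OF less_imp_le[OF assms(1)] v zero] assms(1) \<delta>(1)
      by (simp add: powr_powr)
    then show "\<bar>\<Psi> (Lp_class p \<mu> v)\<bar> < \<epsilon>" using \<delta>(2)[OF Lp_class_in_space[OF v]] \<Psi>0 by simp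
  qed (use \<delta> in simp)
qed

text \<open>
  A set of positive \<open>N\<close>-measure meets \<open>{q > 0}\<close> in a set of positive \<open>\<mu>\<close>-measure; splitting
  the intersection with respect to \<open>\<mu>\<close> leaves two parts that are both charged by \<open>N\<close>.
\<close>

lemma nonatomic_density:
  fixes q :: "'a \<Rightarrow> real"
  assumes "non_atomic \<mu>" "integrable \<mu> q" "\<And>t. 0 \<le> q t"
  defines "N \<equiv> density \<mu> (\<lambda>t. ennreal (q t))"
  shows "nonatomic_finite_measure N"
    and "\<And>A. A \<in> sets \<mu> \<Longrightarrow> measure N A = (\<integral>t. indicator A t * q t \<partial>\<mu>)"
proof -
  have [measurable]: "q \<in> borel_measurable \<mu>" using assms(2) by simp
  have sets_N [simp]: "sets N = sets \<mu>" and [simp]: "space N = space \<mu>" by (simp_all add: N_def)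
  have em: "emeasure N A = ennreal (\<integral>t. indicator A t * q t \<partial>\<mu>)" if [measurable]: "A \<in> sets \<mu>" for A
  proof -
    have "emeasure N A = (\<integral>\<^sup>+t. ennreal (indicator A t * q t) \<partial>\<mu>)"
      by (subst N_def, subst emeasure_density) (auto intro!: nn_integral_cong simp: indicator_def)
    also have "\<dots> = ennreal (\<integral>t. indicator A t * q t \<partial>\<mu>)"
      using assms(3) by (intro nn_integral_eq_integral integrable_indicator_mult assms(2) that) auto
    finally show ?thesis .
  qed
  show "measure N A = (\<integral>t. indicator A t * q t \<partial>\<mu>)" if "A \<in> sets \<mu>" for A
    using em[OF that] assms(3) by (simp add: measure_def integral_nonneg_AE)
  interpret N: finite_measure N
    by (rule finite_measureI) (use em[of "space \<mu>"] in simp)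
  have positive: "0 < emeasure N A \<longleftrightarrow> 0 < emeasure \<mu> (A \<inter> {t \<in> space \<mu>. q t > 0})"
    if [measurable]: "A \<in> sets \<mu>" for A
  proof -
    have "emeasure N A = 0 \<longleftrightarrow> A \<in> null_sets N" by (auto simp: null_sets_def)
    also have "\<dots> \<longleftrightarrow> (AE t in \<mu>. t \<in> A \<longrightarrow> ennreal (q t) = 0)"
      by (subst N_def, subst null_sets_density_iff) auto
    also have "\<dots> \<longleftrightarrow> (AE t in \<mu>. t \<notin> A \<inter> {t \<in> space \<mu>. q t > 0})"
      using assms(3) by (intro AE_cong) (auto simp: less_le ennreal_eq_0_iff intro: antisym)
    also have "\<dots> \<longleftrightarrow> emeasure \<mu> (A \<inter> {t \<in> space \<mu>. q t > 0}) = 0"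
      by (subst AE_iff_measurable[OF _ refl]) (auto intro!: arg_cong[where f = "\<lambda>X. emeasure \<mu> X = 0"] dest: sets.sets_into_space)
    finally show ?thesis by (simp add: zero_less_iff_neq_zero)
  qed
  have "non_atomic N"
    unfolding non_atomic_def
  proof (intro ballI impI)
    fix A assume "A \<in> sets N" and pos: "0 < emeasure N A"
    then have A [measurable]: "A \<in> sets \<mu>" by simp
    define A' where "A' = A \<inter> {t \<in> space \<mu>. q t > 0}"
    have A' [measurable]: "A' \<in> sets \<mu>" by (simp add: A'_def)
    have "0 < emeasure \<mu> A'" using positive[OF A] pos by (simp add: A'_def)
    then obtain B where B: "B \<in> sets \<mu>" "B \<subseteq> A'" "0 < emeasure \<mu> B" "emeasure \<mu> B < emeasure \<mu> A'"
      using assms(1) A' unfolding non_atomic_def by blast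
    note B(1) [measurable]
    have "B \<inter> {t \<in> space \<mu>. q t > 0} = B" using B(2) by (auto simp: A'_def)
    then have NB: "0 < emeasure N B" using positive[OF B(1)] B(3) by simp
    have "emeasure \<mu> A' = emeasure \<mu> B + emeasure \<mu> (A' - B)"
      using B(2) by (subst plus_emeasure) (auto simp: Un_absorb1)
    then have "0 < emeasure \<mu> (A' - B)"
      using B(4) by (metis add.right_neutral less_irrefl zero_less_iff_neq_zero)
    moreover have "(A' - B) \<inter> {t \<in> space \<mu>. q t > 0} = A' - B" by (auto simp: A'_def)
    ultimately have "0 < emeasure N (A' - B)" using positive[of "A' - B"] by simp
    then have "0 < measure N (A' - B)" by (simp add: N.emeasure_eq_measure)
    also have "measure N (A' - B) \<le> measure N (A - B)"
      by (intro N.finite_measure_mono) (auto simp: A'_def)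
    also have "\<dots> = measure N A - measure N B"
      using B(2) by (intro N.finite_measure_Diff) (auto simp: A'_def)
    finally have "emeasure N B < emeasure N A" by (simp add: N.emeasure_eq_measure ennreal_less_iff)
    then show "\<exists>B\<in>sets N. B \<subseteq> A \<and> 0 < emeasure N B \<and> emeasure N B < emeasure N A"
      using B NB by (intro bexI[of _ B]) (auto simp: A'_def)
  qed
  then show "nonatomic_finite_measure N" by unfold_locales
qed

text \<open>
  Lyapunov's theorem is applied to the finite measure whose density \<open>q\<close> is the sum of
  \<open>\<parallel>h\<parallel>\<^sup>p\<close> and all \<open>\<bar>\<phi>\<bar>\<close>. With this choice \<open>\<bar>\<integral>\<^sub>A \<phi>\<bar> \<le> N A\<close> and \<open>\<integral>\<^sub>A \<parallel>h\<parallel>\<^sup>p \<le> N A\<close>, so that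
  absolute continuity of all the charges is immediate.
\<close>

lemma Lyapunov_Lp:
  fixes \<mu> :: "'a measure" and \<Phi> :: "('a \<Rightarrow> real) set"
  assumes na: "non_atomic \<mu>" and "0 < p" and \<psi>: "continuous_linear_on_Lp p \<mu> \<psi>"
    and h: "h \<in> Lp_fun p \<mu>" and \<Phi>: "finite \<Phi>" "\<And>\<phi>. \<phi> \<in> \<Phi> \<Longrightarrow> integrable \<mu> \<phi>"
    and \<tau>: "0 \<le> \<tau>" "\<tau> \<le> 1"
  obtains A where "A \<in> sets \<mu>" "\<psi> (\<lambda>t. indicator A t *\<^sub>R h t) = \<tau> * \<psi> h"
    "\<And>\<phi>. \<phi> \<in> \<Phi> \<Longrightarrow> (\<integral>t. indicator A t * \<phi> t \<partial>\<mu>) = \<tau> * (\<integral>t. \<phi> t \<partial>\<mu>)"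
proof -
  define q where "q t = norm (h t) powr p + (\<Sum>\<phi>\<in>\<Phi>. \<bar>\<phi> t\<bar>)" for t
  have q_int: "integrable \<mu> q"
    unfolding q_def using Lp_fun_integrable[OF h] \<Phi> by auto
  have q_nonneg: "0 \<le> q t" for t unfolding q_def by (intro add_nonneg_nonneg sum_nonneg) auto
  have q_h: "norm (h t) powr p \<le> q t" for t
    unfolding q_def by (simp add: sum_nonneg)
  have q_\<phi>: "\<bar>\<phi> t\<bar> \<le> q t" if "\<phi> \<in> \<Phi>" for \<phi> t
    using member_le_sum[OF that, of "\<lambda>\<phi>. \<bar>\<phi> t\<bar>"] \<Phi>(1) unfolding q_def
    by (simp add: add_increasing)
  define N where "N = density \<mu> (\<lambda>t. ennreal (q t))"
  interpret N: nonatomic_finite_measure N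
    unfolding N_def by (rule nonatomic_density[OF na q_int q_nonneg])
  have sets_N: "sets N = sets \<mu>" by (simp add: N_def)
  have N_eq: "measure N A = (\<integral>t. indicator A t * q t \<partial>\<mu>)" if "A \<in> sets \<mu>" for A
    unfolding N_def by (rule nonatomic_density(2)[OF na q_int q_nonneg that])
  let ?m = "\<lambda>A. \<psi> (\<lambda>t. indicator A t *\<^sub>R h t)"
  let ?i = "\<lambda>(\<phi> :: 'a \<Rightarrow> real) A. (\<integral>t. indicator A t * \<phi> t \<partial>\<mu>)"
  have "ac_charge N ?m"
    unfolding ac_charge_def
  proof (intro conjI ballI allI impI)
    fix A B assume AB: "A \<in> sets N" "B \<in> sets N" "A \<inter> B = {}"
    have "(\<lambda>t. indicator (A \<union> B) t *\<^sub>R h t) = (\<lambda>t. indicator A t *\<^sub>R h t + indicator B t *\<^sub>R h t)"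
      using AB(3) by (auto simp: indicator_def fun_eq_iff)
    then show "?m (A \<union> B) = ?m A + ?m B"
      using continuous_linear_add[OF \<psi> Lp_fun_restrict[OF h] Lp_fun_restrict[OF h]] AB
      by (simp add: sets_N)
  next
    fix \<epsilon> :: real assume "0 < \<epsilon>"
    then obtain \<delta> where \<delta>: "\<delta> > 0"
      "\<And>v. v \<in> Lp_fun p \<mu> \<Longrightarrow> (\<integral>t. norm (v t) powr p \<partial>\<mu>) < \<delta> \<Longrightarrow> \<bar>\<psi> v\<bar> < \<epsilon>"
      using \<psi> unfolding continuous_linear_on_Lp_def by meson
    have "\<bar>?m A\<bar> < \<epsilon>" if A: "A \<in> sets N" "measure N A < \<delta>" for A
    proof (rule \<delta>(2))
      show L: "(\<lambda>t. indicator A t *\<^sub>R h t) \<in> Lp_fun p \<mu>"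
        using A h by (intro Lp_fun_restrict) (auto simp: sets_N)
      have "(\<integral>t. norm (indicator A t *\<^sub>R h t) powr p \<partial>\<mu>) \<le> (\<integral>t. indicator A t * q t \<partial>\<mu>)"
        using A q_int q_h Lp_fun_integrable[OF L]
        by (intro integral_mono integrable_indicator_mult) (auto simp: sets_N indicator_def)
      then show "(\<integral>t. norm (indicator A t *\<^sub>R h t) powr p \<partial>\<mu>) < \<delta>"
        using A N_eq by (simp add: sets_N)
    qed
    then show "\<exists>\<delta>>0. \<forall>A\<in>sets N. measure N A < \<delta> \<longrightarrow> \<bar>?m A\<bar> < \<epsilon>" using \<delta>(1) by blast
  qed
  moreover have "ac_charge N (?i \<phi>)" if "\<phi> \<in> \<Phi>" for \<phi>
    unfolding ac_charge_def
  proof (intro conjI ballI allI impI)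
    fix A B assume AB: "A \<in> sets N" "B \<in> sets N" "A \<inter> B = {}"
    have "(\<lambda>t. indicator (A \<union> B) t * \<phi> t) = (\<lambda>t. indicator A t * \<phi> t + indicator B t * \<phi> t)"
      using AB(3) by (auto simp: indicator_def fun_eq_iff)
    then show "?i \<phi> (A \<union> B) = ?i \<phi> A + ?i \<phi> B"
      using Bochner_Integration.integral_add[OF integrable_indicator_mult[OF _ \<Phi>(2)[OF that]]
          integrable_indicator_mult[OF _ \<Phi>(2)[OF that]]] AB by (simp add: sets_N)
  next
    fix \<epsilon> :: real assume "0 < \<epsilon>"
    moreover have "\<bar>?i \<phi> A\<bar> \<le> measure N A" if A: "A \<in> sets N" for A
    proof -
      have "\<bar>?i \<phi> A\<bar> \<le> (\<integral>t. \<bar>indicator A t * \<phi> t\<bar> \<partial>\<mu>)" by (rule integral_abs_bound)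
      also have "\<dots> \<le> (\<integral>t. indicator A t * q t \<partial>\<mu>)"
        using A q_int \<Phi>(2)[OF \<open>\<phi> \<in> \<Phi>\<close>] q_\<phi>[OF \<open>\<phi> \<in> \<Phi>\<close>]
        by (intro integral_mono integrable_abs integrable_indicator_mult) (auto simp: sets_N indicator_def)
      finally show ?thesis using N_eq A by (simp add: sets_N)
    qed
    ultimately show "\<exists>\<delta>>0. \<forall>A\<in>sets N. measure N A < \<delta> \<longrightarrow> \<bar>?i \<phi> A\<bar> < \<epsilon>"
      by (meson le_less_trans)
  qed
  moreover define m where "m = ?m"
  moreover define i where "i = ?i"
  ultimately have "ac_charge N m" "\<And>\<phi>. \<phi> \<in> \<Phi> \<Longrightarrow> ac_charge N (i \<phi>)" by simp_all
  then have "\<exists>A\<in>sets N. A \<subseteq> space \<mu> \<and> (\<forall>c\<in>insert m (i ` \<Phi>). c A = \<tau> * c (space \<mu>))"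
    using \<Phi>(1) \<tau> by (intro N.Lyapunov_subset) (auto simp: sets_N)
  then obtain A where A: "A \<in> sets \<mu>" "m A = \<tau> * m (space \<mu>)"
      "\<And>\<phi>. \<phi> \<in> \<Phi> \<Longrightarrow> i \<phi> A = \<tau> * i \<phi> (space \<mu>)"
    by (auto simp: sets_N)
  have "?m (space \<mu>) = \<psi> h"
  proof -
    have "AE t in \<mu>. indicator (space \<mu>) t *\<^sub>R h t = h t" by (rule AE_I2) simp
    then show ?thesis by (rule continuous_linear_cong_AE[OF \<psi> Lp_fun_restrict[OF h sets.top] h])
  qed
  moreover have "?i \<phi> (space \<mu>) = (\<integral>t. \<phi> t \<partial>\<mu>)" for \<phi>
    by (rule Bochner_Integration.integral_cong) auto
  ultimately show ?thesis using that[of A] A by (simp add: m_def i_def)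
qed

section \<open>Splicing functions on the constraint set\<close>

text \<open>
  The constraint set \<open>\<psi> u = \<integral> g(t, u(t)) d\<mu>\<close> on the level of functions. The assumption
  \<open>steep\<close> is what is left of the comparison between the Lipschitz constant and the dual
  norm: there is one direction in which \<open>\<psi>\<close> outgrows every variation of the integral
  functional.
\<close>

locale Lp_constraint =
  fixes \<mu> :: "'a measure" and p L :: real
    and \<psi> :: "('a \<Rightarrow> 'e::{banach, second_countable_topology}) \<Rightarrow> real"
    and g :: "'a \<Rightarrow> 'e \<Rightarrow> real"
  assumes nonatomic: "non_atomic \<mu>"
    and p: "1 \<le> p"
    and \<psi>: "continuous_linear_on_Lp p \<mu> \<psi>"
    and g: "g \<in> A_class p \<mu>"
    and Lipschitz: "\<And>u v. u \<in> Lp_fun p \<mu> \<Longrightarrow> v \<in> Lp_fun p \<mu> \<Longrightarrow>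
      \<bar>(\<integral>t. g t (u t) \<partial>\<mu>) - (\<integral>t. g t (v t) \<partial>\<mu>)\<bar> \<le> L * (\<integral>t. norm (u t - v t) powr p \<partial>\<mu>) powr (1 / p)"
    and steep: "\<exists>v\<in>Lp_fun p \<mu>. L * (\<integral>t. norm (v t) powr p \<partial>\<mu>) powr (1 / p) < \<psi> v"
begin

abbreviation I :: "('a \<Rightarrow> 'e \<Rightarrow> real) \<Rightarrow> ('a \<Rightarrow> 'e) \<Rightarrow> real" where
  "I r u \<equiv> (\<integral>t. r t (u t) \<partial>\<mu>)"

definition V :: "('a \<Rightarrow> 'e) set" where
  "V = {u \<in> Lp_fun p \<mu>. \<psi> u = I g u}"

definition splice :: "'a set \<Rightarrow> ('a \<Rightarrow> 'e) \<Rightarrow> ('a \<Rightarrow> 'e) \<Rightarrow> 'a \<Rightarrow> 'e" where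
  "splice A w u t = (if t \<in> A then w t else u t)"

lemma splice_eq: "splice A w u = (\<lambda>t. u t + indicator A t *\<^sub>R (w t - u t))"
  by (auto simp: splice_def indicator_def fun_eq_iff)

lemma V_Lp: "u \<in> V \<Longrightarrow> u \<in> Lp_fun p \<mu>"
  by (simp add: V_def)

lemma splice_Lp:
  assumes "u \<in> Lp_fun p \<mu>" "w \<in> Lp_fun p \<mu>" "A \<in> sets \<mu>"
  shows "splice A w u \<in> Lp_fun p \<mu>"
  unfolding splice_eq using p assms by (intro Lp_fun_add Lp_fun_restrict Lp_fun_diff) auto

lemma integrable_A_class: "r \<in> A_class p \<mu> \<Longrightarrow> u \<in> Lp_fun p \<mu> \<Longrightarrow> integrable \<mu> (\<lambda>t. r t (u t))"
  by (simp add: A_class_def)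

lemma \<psi>_diff:
  assumes "u \<in> Lp_fun p \<mu>" "v \<in> Lp_fun p \<mu>"
  shows "\<psi> (\<lambda>t. u t - v t) = \<psi> u - \<psi> v"
proof -
  have "\<psi> (\<lambda>t. u t + (-1) *\<^sub>R v t) = \<psi> u + (-1) * \<psi> v"
    using continuous_linear_add[OF \<psi> assms(1) Lp_fun_scale[OF assms(2)]]
      continuous_linear_scale[OF \<psi> assms(2)] by metis
  then show ?thesis by simp
qed

lemma I_splice:
  assumes r: "r \<in> A_class p \<mu>" and u: "u \<in> Lp_fun p \<mu>" and w: "w \<in> Lp_fun p \<mu>" and A: "A \<in> sets \<mu>"
  shows "I r (splice A w u) = I r u + (\<integral>t. indicator A t * (r t (w t) - r t (u t)) \<partial>\<mu>)"
proof -
  have "I r (splice A w u) = (\<integral>t. r t (u t) + indicator A t * (r t (w t) - r t (u t)) \<partial>\<mu>)"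
    by (intro Bochner_Integration.integral_cong) (auto simp: splice_def)
  also have "\<dots> = I r u + (\<integral>t. indicator A t * (r t (w t) - r t (u t)) \<partial>\<mu>)"
    using r u w A
    by (intro Bochner_Integration.integral_add integrable_indicator_mult
        Bochner_Integration.integrable_diff integrable_A_class)
  finally show ?thesis .
qed

text \<open>
  On integral functionals, replacing \<open>u\<close> by \<open>w\<close> on \<open>A\<close> acts by adding the integral of
  \<open>r(t, w(t)) - r(t, u(t))\<close> over \<open>A\<close>, and on \<open>\<psi>\<close> by adding \<open>\<psi> ((w - u) 1\<^sub>A)\<close>. Both are
  charges covered by \<open>Lyapunov_Lp\<close>. The further functions \<open>\<phi>\<close> serve to control the size of
  \<open>A\<close>.
\<close>

lemma proportional_splice:
  assumes u: "u \<in> Lp_fun p \<mu>" and w: "w \<in> Lp_fun p \<mu>"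
    and R: "finite R" "R \<subseteq> A_class p \<mu>"
    and \<Phi>: "finite \<Phi>" "\<And>\<phi>. \<phi> \<in> \<Phi> \<Longrightarrow> integrable \<mu> \<phi>"
    and \<tau>: "0 \<le> \<tau>" "\<tau> \<le> 1"
  obtains A where "A \<in> sets \<mu>" "\<psi> (splice A w u) = \<psi> u + \<tau> * (\<psi> w - \<psi> u)"
    "\<And>r. r \<in> R \<Longrightarrow> I r (splice A w u) = I r u + \<tau> * (I r w - I r u)"
    "\<And>\<phi>. \<phi> \<in> \<Phi> \<Longrightarrow> (\<integral>t. indicator A t * \<phi> t \<partial>\<mu>) = \<tau> * (\<integral>t. \<phi> t \<partial>\<mu>)"
proof -
  have p0: "0 < p" using p by simp
  define h where "h t = w t - u t" for t
  have h: "h \<in> Lp_fun p \<mu>" unfolding h_def using p0 u w by (intro Lp_fun_diff) auto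
  define \<Phi>' where "\<Phi>' = \<Phi> \<union> (\<lambda>r t. r t (w t) - r t (u t)) ` R"
  have \<Phi>': "finite \<Phi>'" "\<phi> \<in> \<Phi>' \<Longrightarrow> integrable \<mu> \<phi>" for \<phi>
    using \<Phi> R integrable_A_class[OF _ u] integrable_A_class[OF _ w] unfolding \<Phi>'_def by auto
  obtain A where A: "A \<in> sets \<mu>" "\<psi> (\<lambda>t. indicator A t *\<^sub>R h t) = \<tau> * \<psi> h"
    "\<And>\<phi>. \<phi> \<in> \<Phi>' \<Longrightarrow> (\<integral>t. indicator A t * \<phi> t \<partial>\<mu>) = \<tau> * (\<integral>t. \<phi> t \<partial>\<mu>)"
    using Lyapunov_Lp[OF nonatomic p0 \<psi> h \<Phi>' \<tau>] by metis
  show ?thesis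
  proof (rule that[OF A(1)])
    have "\<psi> (splice A w u) = \<psi> u + \<psi> (\<lambda>t. indicator A t *\<^sub>R h t)"
      unfolding splice_eq h_def[symmetric]
      by (rule continuous_linear_add[OF \<psi> u Lp_fun_restrict[OF h A(1)]])
    moreover have "\<psi> h = \<psi> w - \<psi> u" unfolding h_def by (rule \<psi>_diff[OF w u])
    ultimately show "\<psi> (splice A w u) = \<psi> u + \<tau> * (\<psi> w - \<psi> u)"
      using A(2) by simp
  next
    fix r assume r: "r \<in> R"
    have "I r (splice A w u) = I r u + \<tau> * (\<integral>t. r t (w t) - r t (u t) \<partial>\<mu>)"
      using I_splice[OF _ u w A(1), of r] A(3)[of "\<lambda>t. r t (w t) - r t (u t)"] r R
      by (auto simp: \<Phi>'_def)
    also have "(\<integral>t. r t (w t) - r t (u t) \<partial>\<mu>) = I r w - I r u"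
      using r R u w by (intro Bochner_Integration.integral_diff integrable_A_class) auto
    finally show "I r (splice A w u) = I r u + \<tau> * (I r w - I r u)" .
  qed (use A(3) in \<open>auto simp: \<Phi>'_def\<close>)
qed

lemma integrable_norm_diff:
  "u \<in> Lp_fun p \<mu> \<Longrightarrow> w \<in> Lp_fun p \<mu> \<Longrightarrow> integrable \<mu> (\<lambda>t. norm (w t - u t) powr p)"
  using p by (intro Lp_fun_integrable Lp_fun_diff) auto

text \<open>
  This replaces an intermediate value argument along a path in the constraint set. Splicing
  keeps the constraint exactly, and since every value of the splice is a value of \<open>v\<close> or of
  \<open>w\<close>, it keeps the distance to \<open>u\<close> under control as well.
\<close>

lemma splice_attains_intermediate_value:
  assumes v: "v \<in> V" and w: "w \<in> V" and u: "u \<in> Lp_fun p \<mu>" and r: "r \<in> A_class p \<mu>"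
    and l: "I r v \<le> l" "l \<le> I r w"
  shows "\<exists>z\<in>V. I r z = l \<and> (\<integral>t. norm (z t - u t) powr p \<partial>\<mu>)
    \<le> (\<integral>t. norm (v t - u t) powr p \<partial>\<mu>) + (\<integral>t. norm (w t - u t) powr p \<partial>\<mu>)"
proof -
  obtain \<tau> where \<tau>: "0 \<le> \<tau>" "\<tau> \<le> 1" "I r v + \<tau> * (I r w - I r v) = l"
  proof (cases "I r w = I r v")
    case True
    then show ?thesis using that[of 0] l by simp
  next
    case False
    then show ?thesis using that[of "(l - I r v) / (I r w - I r v)"] l by simp
  qed
  obtain A where A: "A \<in> sets \<mu>" "\<psi> (splice A w v) = \<psi> v + \<tau> * (\<psi> w - \<psi> v)"
    "\<And>r'. r' \<in> {r, g} \<Longrightarrow> I r' (splice A w v) = I r' v + \<tau> * (I r' w - I r' v)"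
    using proportional_splice[OF V_Lp[OF v] V_Lp[OF w], of "{r, g}" "{}" \<tau>] \<tau> r g by auto
  have L: "splice A w v \<in> Lp_fun p \<mu>" using splice_Lp[OF V_Lp[OF v] V_Lp[OF w] A(1)] .
  have "splice A w v \<in> V" using A(2) A(3)[of g] v w L by (simp add: V_def)
  moreover have "I r (splice A w v) = l" using A(3)[of r] \<tau>(3) by simp
  moreover have "(\<integral>t. norm (splice A w v t - u t) powr p \<partial>\<mu>)
      \<le> (\<integral>t. norm (v t - u t) powr p + norm (w t - u t) powr p \<partial>\<mu>)"
    using integrable_norm_diff[OF u L] integrable_norm_diff[OF u V_Lp[OF v]]
      integrable_norm_diff[OF u V_Lp[OF w]]
    by (intro integral_mono Bochner_Integration.integrable_add) (auto simp: splice_def)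
  ultimately show ?thesis using integrable_norm_diff[OF u] V_Lp[OF v] V_Lp[OF w] by auto
qed

text \<open>
  Local minima on the constraint set are global: a splice that contains a small share of \<open>w\<close>
  is close to \<open>u\<close>, and inherits the same share of the descent.
\<close>

lemma descent_nearby:
  assumes u: "u \<in> V" and w: "w \<in> V" and r: "r \<in> A_class p \<mu>" and less: "I r w < I r u" and e: "0 < e"
  shows "\<exists>v\<in>V. I r v < I r u \<and> (\<integral>t. norm (v t - u t) powr p \<partial>\<mu>) < e"
proof -
  define K where "K = (\<integral>t. norm (w t - u t) powr p \<partial>\<mu>)"
  have K: "0 \<le> K" by (simp add: K_def)
  define \<tau> where "\<tau> = e / (e + K)"
  have \<tau>: "0 < \<tau>" "\<tau> \<le> 1" "\<tau> * K < e" using K e by (auto simp: \<tau>_def field_simps)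
  obtain A where A: "A \<in> sets \<mu>" "\<psi> (splice A w u) = \<psi> u + \<tau> * (\<psi> w - \<psi> u)"
    "\<And>r'. r' \<in> {r, g} \<Longrightarrow> I r' (splice A w u) = I r' u + \<tau> * (I r' w - I r' u)"
    "(\<integral>t. indicator A t * norm (w t - u t) powr p \<partial>\<mu>) = \<tau> * K"
    using proportional_splice[OF V_Lp[OF u] V_Lp[OF w], of "{r, g}" "{\<lambda>t. norm (w t - u t) powr p}" \<tau>]
      \<tau> r g integrable_norm_diff[OF V_Lp[OF u] V_Lp[OF w]] by (auto simp: K_def)
  have "splice A w u \<in> V"
    using A(2) A(3)[of g] u w splice_Lp[OF V_Lp[OF u] V_Lp[OF w] A(1)] by (simp add: V_def)
  moreover have "I r (splice A w u) < I r u"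
    using A(3)[of r] \<tau>(1) less by (simp add: mult_pos_neg)
  moreover have "(\<integral>t. norm (splice A w u t - u t) powr p \<partial>\<mu>)
      = (\<integral>t. indicator A t * norm (w t - u t) powr p \<partial>\<mu>)"
    by (intro Bochner_Integration.integral_cong) (auto simp: splice_def)
  ultimately show ?thesis using A(4) \<tau>(3) by auto
qed

lemma Lp_norm_scale:
  "(\<integral>t. norm (a *\<^sub>R v t) powr p \<partial>\<mu>) powr (1 / p) = \<bar>a\<bar> * (\<integral>t. norm (v t) powr p \<partial>\<mu>) powr (1 / p)"
  for v :: "'a \<Rightarrow> 'e"
  using p by (simp add: powr_mult powr_powr)

text \<open>
  Let \<open>d\<close> be the defect \<open>\<psi> u - I g u\<close>. Moving from \<open>u\<close> by \<open>S\<close> times the steep direction,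
  with the sign opposite to that of \<open>d\<close>, changes the defect by some \<open>\<Delta>\<close> of size at least
  \<open>\<kappa> S\<close>. Splicing in the share \<open>\<tau> = - d / \<Delta>\<close> of the moved function cancels the defect
  exactly. As \<open>S\<close> grows \<open>\<tau>\<close> tends to 0, and with it the cost \<open>2 \<tau> \<integral> M\<close> in \<open>I r\<close>.
\<close>

lemma constraint_repaired_cheaply:
  assumes u: "u \<in> Lp_fun p \<mu>" and r: "r \<in> A_class p \<mu>" and M: "integrable \<mu> M"
    and bound: "AE t in \<mu>. \<forall>x. \<bar>r t x\<bar> \<le> M t" and e: "0 < e"
  shows "\<exists>w\<in>V. I r w < I r u + e"
proof -
  define d where "d = \<psi> u - I g u"
  show ?thesis
  proof (cases "d = 0")
    case True
    then show ?thesis using u e by (intro bexI[of _ u]) (auto simp: V_def d_def)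
  next
    case False
    obtain v where v: "v \<in> Lp_fun p \<mu>" "L * (\<integral>t. norm (v t) powr p \<partial>\<mu>) powr (1 / p) < \<psi> v"
      using steep by blast
    define nv where "nv = (\<integral>t. norm (v t) powr p \<partial>\<mu>) powr (1 / p)"
    define \<kappa> where "\<kappa> = \<psi> v - L * nv"
    have \<kappa>: "0 < \<kappa>" using v(2) by (simp add: \<kappa>_def nv_def)
    define K where "K = (\<integral>t. M t \<partial>\<mu>)"
    have M0: "AE t in \<mu>. 0 \<le> M t"
      using bound by eventually_elim (meson abs_ge_zero order_trans)
    then have K: "0 \<le> K" unfolding K_def by (rule integral_nonneg_AE)
    \<comment> \<open>Chosen so that \<open>\<bar>d\<bar> / (S * \<kappa>) = e / (e + 2 * K)\<close>, which makes the cost \<open>2 * \<tau> * K\<close> less than \<open>e\<close>.\<close>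
    define S where "S = \<bar>d\<bar> / \<kappa> * ((e + 2 * K) / e)"
    have S: "0 < S" using False \<kappa> K e by (simp add: S_def)
    define s where "s = - sgn d * S"
    have abs_s: "\<bar>s\<bar> = S" using False S by (simp add: s_def abs_mult)
    define y where "y t = u t + s *\<^sub>R v t" for t
    have y: "y \<in> Lp_fun p \<mu>"
      unfolding y_def using p u v by (intro Lp_fun_add Lp_fun_scale) auto
    define \<Delta> where "\<Delta> = (\<psi> y - I g y) - d"
    have \<psi>y: "\<psi> y = \<psi> u + s * \<psi> v"
      unfolding y_def using continuous_linear_add[OF \<psi> u Lp_fun_scale[OF v(1)]]
        continuous_linear_scale[OF \<psi> v(1)] by metis
    have "\<bar>I g y - I g u\<bar> \<le> L * (\<integral>t. norm (y t - u t) powr p \<partial>\<mu>) powr (1 / p)"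
      using Lipschitz[OF y u] .
    also have "\<dots> = S * (L * nv)"
      unfolding y_def nv_def using Lp_norm_scale[of s v] abs_s by simp
    finally have Ig: "\<bar>I g y - I g u\<bar> \<le> S * (L * nv)" .
    have \<Delta>_eq: "\<Delta> = s * \<psi> v - (I g y - I g u)" using \<psi>y by (simp add: \<Delta>_def d_def)
    have \<Delta>: "S * \<kappa> \<le> - sgn d * \<Delta>"
    proof (cases "d > 0")
      case True
      then show ?thesis using Ig \<Delta>_eq by (simp add: s_def \<kappa>_def right_diff_distrib)
    next
      case d: False
      then show ?thesis using False Ig \<Delta>_eq by (simp add: s_def \<kappa>_def right_diff_distrib)
    qed
    have S\<kappa>: "S * \<kappa> = \<bar>d\<bar> * ((e + 2 * K) / e)" using \<kappa> by (simp add: S_def)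
    have S\<kappa>_pos: "0 < S * \<kappa>" using S \<kappa> by simp
    define \<tau> where "\<tau> = - d / \<Delta>"
    have \<tau>_eq: "\<tau> = \<bar>d\<bar> / (- sgn d * \<Delta>)"
      using False by (auto simp: \<tau>_def sgn_if abs_if)
    have \<tau>_le: "\<tau> \<le> e / (e + 2 * K)"
    proof -
      have "0 < - sgn d * \<Delta>" using \<Delta> S\<kappa>_pos by linarith
      then have "\<tau> \<le> \<bar>d\<bar> / (S * \<kappa>)"
        unfolding \<tau>_eq by (rule divide_left_mono[OF \<Delta> abs_ge_zero mult_pos_pos[OF _ S\<kappa>_pos]])
      also have "\<dots> = e / (e + 2 * K)" unfolding S\<kappa> using False by simp
      finally show ?thesis .
    qed
    have \<tau>: "0 \<le> \<tau>" unfolding \<tau>_eq using \<Delta> S\<kappa>_pos by (intro divide_nonneg_nonneg) auto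
    have "e / (e + 2 * K) \<le> 1" using e K by simp
    with \<tau>_le have \<tau>1: "\<tau> \<le> 1" by simp
    obtain A where A: "A \<in> sets \<mu>" "\<psi> (splice A y u) = \<psi> u + \<tau> * (\<psi> y - \<psi> u)"
      "I g (splice A y u) = I g u + \<tau> * (I g y - I g u)"
      "(\<integral>t. indicator A t * M t \<partial>\<mu>) = \<tau> * K"
      using proportional_splice[OF u y, of "{g}" "{M}" \<tau>] \<tau> \<tau>1 g M by (auto simp: K_def)
    have "\<psi> (splice A y u) - I g (splice A y u) = d + \<tau> * \<Delta>"
      unfolding A(2,3) \<Delta>_def d_def by (simp add: algebra_simps)
    also have "\<dots> = 0" using \<Delta> S\<kappa>_pos by (auto simp: \<tau>_def)
    finally have "splice A y u \<in> V" using splice_Lp[OF u y A(1)] by (simp add: V_def)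
    moreover have "I r (splice A y u) < I r u + e"
    proof -
      have "(\<integral>t. indicator A t * (r t (y t) - r t (u t)) \<partial>\<mu>) \<le> (\<integral>t. indicator A t * (2 * M t) \<partial>\<mu>)"
      proof (rule integral_mono_AE)
        show "AE t in \<mu>. indicator A t * (r t (y t) - r t (u t)) \<le> indicator A t * (2 * M t)"
          using bound
        proof eventually_elim
          case (elim t)
          then have "\<bar>r t (y t)\<bar> \<le> M t" "\<bar>r t (u t)\<bar> \<le> M t" by blast+
          then show ?case by (auto simp: indicator_def)
        qed
      next
        show "integrable \<mu> (\<lambda>t. indicator A t * (r t (y t) - r t (u t)))"
          by (intro integrable_indicator_mult[OF A(1)] Bochner_Integration.integrable_diff
              integrable_A_class[OF r y] integrable_A_class[OF r u])
        show "integrable \<mu> (\<lambda>t. indicator A t * (2 * M t))"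
          using M by (intro integrable_indicator_mult[OF A(1)]) simp
      qed
      also have "\<dots> = 2 * (\<tau> * K)"
        unfolding A(4)[symmetric] by (subst integral_mult_right_zero[symmetric]) (simp add: mult.left_commute)
      also have "\<dots> < e"
      proof -
        have "2 * (\<tau> * K) \<le> 2 * (e / (e + 2 * K) * K)"
          using \<tau>_le K by (intro mult_left_mono mult_right_mono) auto
        also have "\<dots> < e" using e K by (simp add: field_simps)
        finally show ?thesis .
      qed
      finally show ?thesis using I_splice[OF r u y A(1)] by simp
    qed
    ultimately show ?thesis by blast
  qed
qed

text \<open>
  By continuity the points at which \<open>r(t, \<cdot>)\<close> is below \<open>r(t, u(t))\<close> form a nonempty open set
  for \<open>t \<in> D\<close>, so one of them lies in a fixed countable dense set. Hence a single constant
  lowers the integrand on a set of positive measure. By \<open>\<sigma>\<close>-finiteness that set may be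
  shrunk to finite measure, which keeps the function in \<open>L\<^sup>p\<close>.
\<close>

lemma lowered_by_constant:
  assumes "sigma_finite_measure \<mu>" and u: "u \<in> Lp_fun p \<mu>" and r: "r \<in> A_class p \<mu>"
    and D: "D \<in> sets \<mu>" "0 < emeasure \<mu> D"
    and no_min: "\<And>t x. t \<in> D \<Longrightarrow> \<exists>y. r t y < r t x"
  shows "\<exists>w\<in>Lp_fun p \<mu>. I r w < I r u"
proof -
  interpret sigma_finite_measure \<mu> by fact
  have Car: "Caratheodory \<mu> r" using r by (simp add: A_class_def)
  have [measurable]: "(\<lambda>t. r t (u t)) \<in> borel_measurable \<mu>" "\<And>x. (\<lambda>t. r t x) \<in> borel_measurable \<mu>"
    using Car Caratheodory_compose_measurable[OF Car Lp_fun_measurable[OF u]]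
    by (auto simp: Caratheodory_def)
  note D(1)[measurable]
  obtain C :: "'e set" where C: "countable C" "\<And>X. open X \<Longrightarrow> X \<noteq> {} \<Longrightarrow> \<exists>d\<in>C. d \<in> X"
    using countable_dense_exists by blast
  define B where "B x = {t \<in> D. r t x < r t (u t)}" for x
  have B: "B x \<in> sets \<mu>" for x
  proof -
    have "B x = D \<inter> {t \<in> space \<mu>. r t x < r t (u t)}"
      using sets.sets_into_space[OF D(1)] by (auto simp: B_def)
    then show ?thesis by simp
  qed
  have "D \<subseteq> (\<Union>x\<in>C. B x)"
  proof
    fix t assume t: "t \<in> D"
    then have "continuous_on UNIV (r t)"
      using Car sets.sets_into_space[OF D(1)] by (auto simp: Caratheodory_def)
    then have "open {x. r t x < r t (u t)}"
      by (intro open_Collect_less continuous_on_const) auto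
    moreover have "{x. r t x < r t (u t)} \<noteq> {}" using no_min[OF t] by blast
    ultimately show "t \<in> (\<Union>x\<in>C. B x)" using C(2) t by (fastforce simp: B_def)
  qed
  have "\<exists>x\<in>C. emeasure \<mu> (B x) \<noteq> 0"
  proof (rule ccontr)
    assume "\<not> ?thesis"
    then have "(\<Union>x\<in>C. B x) \<in> null_sets \<mu>"
      using C(1) B by (intro null_sets_UN') (auto simp: null_sets_def)
    then have "D \<in> null_sets \<mu>" using D(1) \<open>D \<subseteq> _\<close> by (rule null_sets_subset)
    with D(2) show False by (simp add: null_sets_def)
  qed
  then obtain x where x: "emeasure \<mu> (B x) \<noteq> 0" by blast
  obtain A where A: "A \<in> sets \<mu>" "A \<subseteq> B x" "emeasure \<mu> A < \<infinity>" "0 < emeasure \<mu> A"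
  proof (cases "emeasure \<mu> (B x) = \<infinity>")
    case True
    then obtain Z where "Z \<in> sets \<mu>" "Z \<subseteq> B x" "emeasure \<mu> Z < \<infinity>" "ennreal 0 < emeasure \<mu> Z"
      using approx_PInf_emeasure_with_finite[OF B, of x 0] by auto
    then show ?thesis using that by simp
  next
    case False
    then show ?thesis using that[OF B subset_refl] x
      by (simp add: zero_less_iff_neq_zero less_top)
  qed
  note A(1)[measurable]
  define w where "w t = (if t \<in> A then x else u t)" for t
  have w_meas [measurable]: "w \<in> borel_measurable \<mu>"
    unfolding w_def using Lp_fun_measurable[OF u] by measurable
  have w: "w \<in> Lp_fun p \<mu>"
  proof -
    have "integrable \<mu> (\<lambda>t. norm (u t) powr p + indicator A t * norm x powr p)"
      using A Lp_fun_integrable[OF u]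
      by (intro Bochner_Integration.integrable_add integrable_mult_left) auto
    then have "integrable \<mu> (\<lambda>t. norm (w t) powr p)"
    proof (rule Bochner_Integration.integrable_bound)
      show "(\<lambda>t. norm (w t) powr p) \<in> borel_measurable \<mu>" by measurable
    qed (auto simp: w_def intro!: AE_I2)
    then show ?thesis by (simp add: Lp_fun_def)
  qed
  have "I r w < I r u"
  proof -
    let ?gap = "\<lambda>t. r t (u t) - r t (w t)"
    have int: "integrable \<mu> ?gap"
      by (intro Bochner_Integration.integrable_diff integrable_A_class[OF r u] integrable_A_class[OF r w])
    have gap: "0 \<le> ?gap t" "t \<in> A \<Longrightarrow> 0 < ?gap t" for t
      using A(2) by (auto simp: w_def B_def)
    have "(\<integral>t. ?gap t \<partial>\<mu>) \<noteq> 0"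
    proof
      assume "(\<integral>t. ?gap t \<partial>\<mu>) = 0"
      then have "AE t in \<mu>. ?gap t = 0"
        using integral_nonneg_eq_0_iff_AE[OF int] gap(1) by simp
      then have "AE t in \<mu>. t \<notin> A" by eventually_elim (use gap(2) in fastforce)
      then have "A \<in> null_sets \<mu>" using A(1) by (simp add: AE_iff_null_sets)
      with A(4) show False by (simp add: null_sets_def)
    qed
    moreover have "0 \<le> (\<integral>t. ?gap t \<partial>\<mu>)" using gap(1) by (intro Bochner_Integration.integral_nonneg)
    moreover have "(\<integral>t. ?gap t \<partial>\<mu>) = I r u - I r w"
      by (intro Bochner_Integration.integral_diff integrable_A_class[OF r u] integrable_A_class[OF r w])
    ultimately show ?thesis by linarith
  qed
  with w show ?thesis by blast
qed

proposition no_local_minimum_on_constraint: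
  assumes "sigma_finite_measure \<mu>" and u: "u \<in> V" and Car: "Caratheodory \<mu> r"
    and M: "integrable \<mu> M" and bound: "AE t in \<mu>. \<forall>x. \<bar>r t x\<bar> \<le> M t"
    and D: "D \<in> sets \<mu>" "0 < emeasure \<mu> D" "\<And>t x. t \<in> D \<Longrightarrow> \<exists>y. r t y < r t x"
    and e: "0 < e"
  shows "\<exists>v\<in>V. I r v < I r u \<and> (\<integral>t. norm (v t - u t) powr p \<partial>\<mu>) < e"
proof -
  have r: "r \<in> A_class p \<mu>" by (rule A_class_if_growth[OF Car M, of 0]) (use bound in simp)
  obtain w where w: "w \<in> Lp_fun p \<mu>" "I r w < I r u"
    using lowered_by_constant[OF assms(1) V_Lp[OF u] r D] by blast
  obtain w' where "w' \<in> V" "I r w' < I r w + (I r u - I r w)"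
    using constraint_repaired_cheaply[OF w(1) r M bound, of "I r u - I r w"] w(2) by auto
  then show ?thesis using descent_nearby[OF u _ r _ e] by auto
qed

end

section \<open>Attaining prescribed values near a given point\<close>

lemma Lp_space_representative:
  assumes "U \<in> Lp_space p \<mu>"
  obtains u where "u \<in> Lp_fun p \<mu>" "U = Lp_class p \<mu> u"
  using assms unfolding Lp_space_def Lp_class_def by (elim quotientE) blast

text \<open>
  If no direction were steep, \<open>L\<close> would bound \<open>\<bar>\<Psi>\<bar>\<close> on the unit ball and hence the dual
  norm.
\<close>

lemma steep_direction:
  fixes \<Psi> :: "('a \<Rightarrow> 'e::{banach, second_countable_topology}) set \<Rightarrow> real"
  assumes p: "0 < p" and \<Psi>: "\<Psi> \<in> Lp_dual p \<mu>" and L: "0 \<le> L" "L < Lp_dual_norm p \<mu> \<Psi>"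
  shows "\<exists>v\<in>Lp_fun p \<mu>. L * (\<integral>t. norm (v t) powr p \<partial>\<mu>) powr (1 / p) < \<Psi> (Lp_class p \<mu> v)"
proof -
  have "\<exists>U\<in>Lp_space p \<mu>. Lp_norm p \<mu> U \<le> 1 \<and> L < \<bar>\<Psi> U\<bar>"
  proof (rule ccontr)
    assume *: "\<not> ?thesis"
    have zero: "(\<lambda>t. 0 :: 'e) \<in> Lp_fun p \<mu>" by (simp add: Lp_fun_def)
    have "Lp_class p \<mu> (\<lambda>t. 0 :: 'e) \<in> {U \<in> Lp_space p \<mu>. Lp_norm p \<mu> U \<le> 1}"
      using Lp_class_in_space[OF zero] Lp_norm_class[OF zero] by simp
    then have "Lp_dual_norm p \<mu> \<Psi> \<le> L"
      unfolding Lp_dual_norm_def using * by (intro cSUP_least) auto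
    with L show False by simp
  qed
  then obtain U where U: "U \<in> Lp_space p \<mu>" "Lp_norm p \<mu> U \<le> 1" "L < \<bar>\<Psi> U\<bar>" by blast
  obtain v where v: "v \<in> Lp_fun p \<mu>" "U = Lp_class p \<mu> v" using Lp_space_representative[OF U(1)] .
  define nv where "nv = (\<integral>t. norm (v t) powr p \<partial>\<mu>) powr (1 / p)"
  have "nv \<le> 1" using U(2) v Lp_norm_class[OF v(1)] by (simp add: nv_def)
  then have *: "L * nv < \<bar>\<Psi> U\<bar>" using L(1) U(3) mult_left_mono[of nv 1 L] by simp
  show ?thesis
  proof (cases "0 \<le> \<Psi> U")
    case True
    then show ?thesis using * v by (auto simp: nv_def)
  next
    case False
    have "\<Psi> (Lp_class p \<mu> (\<lambda>t. (-1) *\<^sub>R v t)) = (-1) * \<Psi> (Lp_class p \<mu> v)"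
      using continuous_linear_scale[OF Lp_dual_continuous_linear[OF p \<Psi>] v(1)] .
    moreover have "(\<lambda>t. (-1) *\<^sub>R v t) \<in> Lp_fun p \<mu>" by (rule Lp_fun_scale[OF v(1)])
    ultimately show ?thesis
      using False * v by (intro bexI[of _ "\<lambda>t. (-1) *\<^sub>R v t"]) (simp_all add: nv_def)
  qed
qed

text \<open>
  The \<open>n\<close>-th term is a solution whose distance exceeds the infimum over all solutions by
  less than \<open>1 / (n + 1)\<close>. For the finitely many \<open>n\<close> without a solution it is the centre
  \<open>a\<close>.
\<close>

lemma eventually_solvable_arbitrarily_close_imp_sequence:
  fixes d :: "'z \<Rightarrow> real"
  assumes d: "\<And>z. 0 \<le> d z" "d a = 0" and a: "a \<in> S"
    and ex: "\<And>e. 0 < e \<Longrightarrow> \<forall>\<^sub>F n in sequentially. \<exists>z\<in>S. Q n z \<and> d z < e"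
  shows "\<exists>z. (\<forall>n. z n \<in> S) \<and> (\<lambda>n. d (z n)) \<longlonglongrightarrow> 0 \<and> (\<exists>n0. \<forall>n\<ge>n0. Q n (z n))"
proof -
  define Z where "Z n = {z \<in> S. Q n z}" for n
  define i where "i n = Inf (d ` Z n)" for n
  have bdd: "bdd_below (d ` Z n)" for n using d(1) by (intro bdd_belowI2[of _ 0]) auto
  have "\<exists>z. z \<in> S \<and> (Z n \<noteq> {} \<longrightarrow> Q n z \<and> d z < i n + 1 / real (Suc n))" for n
  proof (cases "Z n = {}")
    case False
    then have "\<exists>x\<in>d ` Z n. x < i n + 1 / real (Suc n)"
      unfolding i_def by (intro cInf_lessD) auto
    then show ?thesis by (auto simp: Z_def)
  qed (use a in auto)
  then obtain z where z: "\<And>n. z n \<in> S" "\<And>n. Z n \<noteq> {} \<Longrightarrow> Q n (z n)"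
      "\<And>n. Z n \<noteq> {} \<Longrightarrow> d (z n) < i n + 1 / real (Suc n)" by metis
  have "(\<lambda>n. d (z n)) \<longlonglongrightarrow> 0"
  proof (rule order_tendstoI)
    fix e :: real assume "0 < e"
    have "(\<lambda>n. 1 / real (Suc n)) \<longlonglongrightarrow> 0" by (rule LIMSEQ_Suc[OF lim_1_over_n])
    then have "\<forall>\<^sub>F n in sequentially. 1 / real (Suc n) < e / 2"
      using \<open>0 < e\<close> by (intro order_tendstoD(2)) auto
    moreover have "\<forall>\<^sub>F n in sequentially. \<exists>z\<in>S. Q n z \<and> d z < e / 2"
      using ex[of "e / 2"] \<open>0 < e\<close> by simp
    ultimately show "\<forall>\<^sub>F n in sequentially. d (z n) < e"
    proof eventually_elim
      case (elim n)
      then obtain y where y: "y \<in> Z n" "d y < e / 2" by (auto simp: Z_def)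
      then have "i n \<le> d y" unfolding i_def by (intro cInf_lower bdd) auto
      moreover have "d (z n) < i n + 1 / real (Suc n)" using y(1) by (intro z(3)) auto
      ultimately show ?case using y(2) elim(1) by linarith
    qed
  next
    fix e :: real assume "e < 0"
    then show "\<forall>\<^sub>F n in sequentially. e < d (z n)"
      using d(1) by (intro always_eventually allI) (auto intro: less_le_trans)
  qed
  moreover have "\<forall>\<^sub>F n in sequentially. Q n (z n)"
    using ex[of 1] by (rule eventually_mono) (auto intro!: z(2) simp: Z_def)
  ultimately show ?thesis using z(1) unfolding eventually_sequentially by blast
qed

theorem theorem1:
  fixes \<mu> :: "'a measure"
    and f :: "'a \<Rightarrow> 'e::{banach, second_countable_topology} \<Rightarrow> real"
    and fn :: "nat \<Rightarrow> 'a \<Rightarrow> 'e \<Rightarrow> real"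
    and M :: "'a \<Rightarrow> real"
    and c p :: real
  assumes "sigma_finite_measure \<mu>"
    and "non_atomic \<mu>"
    and "complete_measure \<mu>"
    and "p \<ge> 1"
    and "\<And>n. Caratheodory \<mu> (fn n)"
    and "integrable \<mu> M"
    and "c \<ge> 0"
    and "\<And>n. AE t in \<mu>. \<forall>x. \<bar>fn n t x\<bar> \<le> M t + c * norm x powr p"
    and "\<And>t x. t \<in> space \<mu> \<Longrightarrow> (\<lambda>n. fn n t x) \<longlonglongrightarrow> f t x"
    and "Caratheodory \<mu> f"
    and "AE t in \<mu>. \<forall>x. \<bar>f t x\<bar> \<le> M t"
    and "emeasure \<mu> {t \<in> space \<mu>. no_global_extrema (f t)} > 0"
  shows "\<forall>V \<in> V_family p \<mu>. \<forall>u \<in> V. \<forall>lam :: nat \<Rightarrow> real. lam \<longlonglongrightarrow> J \<mu> f u \<longrightarrow>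
    (\<exists>un. (\<forall>n. un n \<in> V) \<and> (\<lambda>n. Lp_dist p \<mu> (un n) u) \<longlonglongrightarrow> 0 \<and>
       (\<exists>\<nu>::nat. \<forall>n\<ge>\<nu>. J \<mu> (fn n) (un n) = lam n))"
proof (intro ballI allI impI)
  fix V U and lam :: "nat \<Rightarrow> real"
  assume "V \<in> V_family p \<mu>" and UV: "U \<in> V" and lam: "lam \<longlonglongrightarrow> J \<mu> f U"
  then obtain \<Psi> g L where \<Psi>: "\<Psi> \<in> Lp_dual p \<mu>" and g: "g \<in> A_class p \<mu>"
    and L: "0 \<le> L" "L < Lp_dual_norm p \<mu> \<Psi>"
    and Lip: "\<And>U W. U \<in> Lp_space p \<mu> \<Longrightarrow> W \<in> Lp_space p \<mu> \<Longrightarrow> \<bar>J \<mu> g U - J \<mu> g W\<bar> \<le> L * Lp_dist p \<mu> U W"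
    and V: "V = {U \<in> Lp_space p \<mu>. \<Psi> U = J \<mu> g U}"
    unfolding V_family_def by blast
  have p0: "0 < p" using assms(4) by simp
  interpret C: Lp_constraint \<mu> p L "\<lambda>u. \<Psi> (Lp_class p \<mu> u)" g
  proof
    show "continuous_linear_on_Lp p \<mu> (\<lambda>u. \<Psi> (Lp_class p \<mu> u))"
      by (rule Lp_dual_continuous_linear[OF p0 \<Psi>])
    show "\<bar>(\<integral>t. g t (u t) \<partial>\<mu>) - (\<integral>t. g t (v t) \<partial>\<mu>)\<bar>
        \<le> L * (\<integral>t. norm (u t - v t) powr p \<partial>\<mu>) powr (1 / p)"
      if "u \<in> Lp_fun p \<mu>" "v \<in> Lp_fun p \<mu>" for u v
      using Lip[OF that[THEN Lp_class_in_space]] that p0 g by (simp add: J_class Lp_dist_class)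
    show "\<exists>v\<in>Lp_fun p \<mu>. L * (\<integral>t. norm (v t) powr p \<partial>\<mu>) powr (1 / p) < \<Psi> (Lp_class p \<mu> v)"
      by (rule steep_direction[OF p0 \<Psi> L])
  qed (use assms g in auto)
  have class_V: "Lp_class p \<mu> z \<in> V \<longleftrightarrow> z \<in> C.V" if "z \<in> Lp_fun p \<mu>" for z
    using that g by (simp add: V C.V_def Lp_class_in_space J_class)
  obtain u where u: "u \<in> Lp_fun p \<mu>" "U = Lp_class p \<mu> u"
    using UV Lp_space_representative[of U p \<mu>] by (auto simp: V)
  have uV: "u \<in> C.V" using UV u class_V by simp
  have f: "f \<in> A_class p \<mu>"
    by (rule A_class_if_growth[OF assms(10,6), of 0]) (use assms(11) in simp)
  have fn: "fn n \<in> A_class p \<mu>" for n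
    by (rule A_class_if_growth[OF assms(5,6,8)])
  have lam': "lam \<longlonglongrightarrow> C.I f u" using lam J_class[OF f u(1)] u(2) by simp
  have conv: "(\<lambda>n. C.I (fn n) v) \<longlonglongrightarrow> C.I f v" if v: "v \<in> Lp_fun p \<mu>" for v
  proof (rule integral_dominated_convergence)
    show "integrable \<mu> (\<lambda>t. M t + c * norm (v t) powr p)"
      using assms(6) Lp_fun_integrable[OF v] by simp
    show "AE t in \<mu>. (\<lambda>n. fn n t (v t)) \<longlonglongrightarrow> f t (v t)" using assms(9) by (intro AE_I2)
    show "AE t in \<mu>. norm (fn n t (v t)) \<le> M t + c * norm (v t) powr p" for n
      using assms(8)[of n] by eventually_elim simp
  qed (use C.integrable_A_class[OF f v] C.integrable_A_class[OF fn v] in auto)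
  define D where "D = {t \<in> space \<mu>. no_global_extrema (f t)}"
  have D: "D \<in> sets \<mu>" "0 < emeasure \<mu> D"
    using assms(12) emeasure_notin_sets[of D \<mu>] unfolding D_def by (metis less_irrefl)+
  have below: "\<exists>v\<in>C.V. C.I f v < C.I f u \<and> (\<integral>t. norm (v t - u t) powr p \<partial>\<mu>) < e" if "0 < e" for e
  proof (rule C.no_local_minimum_on_constraint[OF assms(1) uV assms(10,6,11) D _ that])
    show "\<exists>y. f t y < f t x" if "t \<in> D" for t x
      using that by (auto simp: D_def no_global_extrema_def not_le)
  qed
  have above: "\<exists>v\<in>C.V. C.I f u < C.I f v \<and> (\<integral>t. norm (v t - u t) powr p \<partial>\<mu>) < e" if "0 < e" for e
  proof -
    have "\<exists>v\<in>C.V. C.I (\<lambda>t x. - f t x) v < C.I (\<lambda>t x. - f t x) u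
        \<and> (\<integral>t. norm (v t - u t) powr p \<partial>\<mu>) < e"
    proof (rule C.no_local_minimum_on_constraint[OF assms(1) uV _ assms(6) _ D _ that])
      show "Caratheodory \<mu> (\<lambda>t x. - f t x)"
        using assms(10) by (auto simp: Caratheodory_def intro!: continuous_on_minus)
      show "\<exists>y. - f t y < - f t x" if "t \<in> D" for t x
        using that by (auto simp: D_def no_global_extrema_def not_le)
    qed (use assms(11) in simp)
    then show ?thesis by simp
  qed
  show "\<exists>un. (\<forall>n. un n \<in> V) \<and> (\<lambda>n. Lp_dist p \<mu> (un n) U) \<longlonglongrightarrow> 0 \<and>
       (\<exists>\<nu>::nat. \<forall>n\<ge>\<nu>. J \<mu> (fn n) (un n) = lam n)"
  proof (rule eventually_solvable_arbitrarily_close_imp_sequence[OF _ _ UV])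
    show "0 \<le> Lp_dist p \<mu> W U" for W by (simp add: Lp_dist_def Lp_norm_def)
    show "Lp_dist p \<mu> U U = 0" using Lp_dist_class[OF _ u(1) u(1)] p0 u(2) by simp
    fix e :: real assume e: "0 < e"
    define e' where "e' = e powr p / 2"
    have "0 < e'" using e by (simp add: e'_def)
    obtain v where v: "v \<in> C.V" "C.I f v < C.I f u" "(\<integral>t. norm (v t - u t) powr p \<partial>\<mu>) < e'"
      using below[OF \<open>0 < e'\<close>] by blast
    obtain w where w: "w \<in> C.V" "C.I f u < C.I f w" "(\<integral>t. norm (w t - u t) powr p \<partial>\<mu>) < e'"
      using above[OF \<open>0 < e'\<close>] by blast
    have "\<forall>\<^sub>F n in sequentially. 0 < lam n - C.I (fn n) v"
      using v(2) by (intro order_tendstoD(1)[OF tendsto_diff[OF lam' conv[OF C.V_Lp[OF v(1)]]]]) simp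
    moreover have "\<forall>\<^sub>F n in sequentially. 0 < C.I (fn n) w - lam n"
      using w(2) by (intro order_tendstoD(1)[OF tendsto_diff[OF conv[OF C.V_Lp[OF w(1)]] lam']]) simp
    ultimately show "\<forall>\<^sub>F n in sequentially. \<exists>W\<in>V. J \<mu> (fn n) W = lam n \<and> Lp_dist p \<mu> W U < e"
    proof eventually_elim
      case (elim n)
      then obtain z where z: "z \<in> C.V" "C.I (fn n) z = lam n" "(\<integral>t. norm (z t - u t) powr p \<partial>\<mu>)
          \<le> (\<integral>t. norm (v t - u t) powr p \<partial>\<mu>) + (\<integral>t. norm (w t - u t) powr p \<partial>\<mu>)"
        using C.splice_attains_intermediate_value[OF v(1) w(1) u(1) fn, of n "lam n"] by auto
      have "(\<integral>t. norm (z t - u t) powr p \<partial>\<mu>) < e powr p"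
        using z(3) v(3) w(3) by (simp add: e'_def)
      then have "(\<integral>t. norm (z t - u t) powr p \<partial>\<mu>) powr (1 / p) < (e powr p) powr (1 / p)"
        using p0 by (intro powr_less_mono2) auto
      then have "Lp_dist p \<mu> (Lp_class p \<mu> z) U < e"
        using Lp_dist_class[OF _ C.V_Lp[OF z(1)] u(1)] p0 e u(2) by (simp add: powr_powr)
      then show ?case
        using z class_V[OF C.V_Lp[OF z(1)]] J_class[OF fn C.V_Lp[OF z(1)]]
        by (intro bexI[of _ "Lp_class p \<mu> z"]) auto
    qed
  qed
qed

end
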